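(* For every ordinal $\alpha<\omega_1^{CK}$ there is an automatic successor tree whose Cantor–Bendixson rank is $\alpha$.
   Context: A partial order tree is a partial order $(T,\le)$ with a $\le$-least element such that for each $y$ the set $\{x\in T:x\le y\}$ is finite and linearly ordered. A successor tree is a pair $(T,S)$ with $S$ a binary relation such that the reflexive transitive closure of $S$ makes $T$ a partial order tree. The derivative $d(T)$ of a tree is the subtree consisting of those nodes lying on at least two infinite paths of $T$; set $d^0(T)=T$, $d^{\beta+1}(T)=d(d^\beta(T))$, and $d^\gamma(T)=\bigcap_{\beta<\gamma}d^\beta(T)$ for limit $\gamma$. The Cantor–Bendixson rank of $T$ is the least $\alpha$ with $d^\alpha(T)=d^{\alpha+1}(T)$. Automatic: for a finite alphabet $\Sigma$ and padding symbol $\diamond\notin\Sigma$, the convolution of a pair of words is the word over $(\Sigma\cup\{\diamond\})^2$ obtained by reading them in parallel, padding the shorter with $\diamond$; a binary relation is regular if its set of convolutions is accepted by a finite automaton; $(T,S)$ is automatic if (up to isomorphism) $T$ is a regular subset of $\Sigma^\star$ and $S$ is regular. *)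

theory Defs
  imports Main
begin

unbundle cardinal_syntax

section \<open>Computable ordinals and the Church--Kleene ordinal\<close>

text \<open>
  Computability is rendered by Minsky register machines with arbitrarily many registers.
  \<open>Inc r l\<close> increments register \<open>r\<close> and jumps to \<open>l\<close>; \<open>Dec r l l'\<close> jumps to \<open>l'\<close> if register
  \<open>r\<close> is zero, and otherwise decrements it and jumps to \<open>l\<close>. The machine halts when the
  program counter leaves the program.
\<close>

datatype instr = Inc nat nat | Dec nat nat nat

type_synonym config = "nat \<times> (nat \<Rightarrow> nat)"

definition halted :: "instr list \<Rightarrow> config \<Rightarrow> bool" where
  "halted p c \<longleftrightarrow> length p \<le> fst c"

fun step :: "instr list \<Rightarrow> config \<Rightarrow> config" where
  "step p (pc, R) =
     (if halted p (pc, R) then (pc, R)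
      else case p ! pc of
        Inc r l \<Rightarrow> (l, R(r := Suc (R r)))
      | Dec r l l' \<Rightarrow> (if R r = 0 then (l', R) else (l, R(r := R r - 1))))"

definition initial_config :: "nat \<Rightarrow> nat \<Rightarrow> config" where
  "initial_config x y = (0, (\<lambda>_. 0)(0 := x, 1 := y))"

definition computable_rel :: "nat rel \<Rightarrow> bool" where
  "computable_rel r \<longleftrightarrow>
     (\<exists>p. \<forall>x y. \<exists>n. let c = (step p ^^ n) (initial_config x y) in
        halted p c \<and> snd c 0 = (if (x, y) \<in> r then 1 else 0))"

text \<open>
  Ordinals are represented by reflexive well-orders (on their field), compared by
  \<open>=o\<close>, \<open>\<le>o\<close>, \<open><o\<close>. A well-order of a subset of the natural numbers that is computable
  as a relation also has a computable field, since \<open>x \<in> Field r \<longleftrightarrow> (x, x) \<in> r\<close>.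
\<close>

definition computable_ordinal :: "'a rel \<Rightarrow> bool" where
  "computable_ordinal \<alpha> \<longleftrightarrow> (\<exists>r :: nat rel. Well_order r \<and> computable_rel r \<and> \<alpha> =o r)"

text \<open>
  The least non-computable ordinal. Type \<^typ>\<open>nat set\<close> is uncountable, so it
  carries a non-computable well-order; see \<open>omega1CK_least\<close> below.
\<close>

definition omega1CK :: "nat set rel" where
  "omega1CK = (SOME w. Well_order w \<and> \<not> computable_ordinal w \<and>
     (\<forall>s :: nat set rel. Well_order s \<and> \<not> computable_ordinal s \<longrightarrow> w \<le>o s))"

lemma computable_ordinal_countable:
  assumes "computable_ordinal \<alpha>"
  shows "\<exists>f :: 'a \<Rightarrow> nat. inj_on f (Field \<alpha>)"
proof -
  obtain r :: "nat rel" where "\<alpha> =o r"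
    using assms unfolding computable_ordinal_def by blast
  then obtain f where "iso \<alpha> r f"
    unfolding ordIso_def by auto
  then show ?thesis
    unfolding iso_def bij_betw_def by auto
qed

lemma ex_non_computable_ordinal:
  "\<exists>w :: nat set rel. Well_order w \<and> \<not> computable_ordinal w"
proof -
  have "\<not> computable_ordinal |UNIV :: nat set set|"
  proof
    assume "computable_ordinal |UNIV :: nat set set|"
    then obtain f :: "nat set \<Rightarrow> nat" where "inj f"
      using computable_ordinal_countable[of "|UNIV :: nat set set|"]
      by (auto simp: Field_card_of)
    then have "surj (inv f)"
      by (rule inj_imp_surj_inv)
    then obtain n where "inv f n = {m. m \<notin> inv f m}"
      by (metis surjD)
    then show False by blast
  qed
  then show ?thesis
    using card_of_Well_order by blast
qed

lemma omega1CK_least: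
  "Well_order omega1CK" "\<not> computable_ordinal omega1CK"
  "Well_order (s :: nat set rel) \<Longrightarrow> \<not> computable_ordinal s \<Longrightarrow> omega1CK \<le>o s"
proof -
  let ?P = "\<lambda>w :: nat set rel. Well_order w \<and> \<not> computable_ordinal w \<and>
     (\<forall>s :: nat set rel. Well_order s \<and> \<not> computable_ordinal s \<longrightarrow> w \<le>o s)"
  let ?N = "{w :: nat set rel. Well_order w \<and> \<not> computable_ordinal w}"
  have "?N \<noteq> {}" using ex_non_computable_ordinal by blast
  then have "\<exists>w\<in>?N. \<forall>s\<in>?N. w \<le>o s"
    by (rule exists_minim_Well_order) simp
  then have "\<exists>w. ?P w"
    by (simp only: Bex_def Ball_def mem_Collect_eq conj_assoc)
  then have *: "?P omega1CK"
    unfolding omega1CK_def by (rule someI_ex)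
  show "Well_order omega1CK" "\<not> computable_ordinal omega1CK"
    "Well_order (s :: nat set rel) \<Longrightarrow> \<not> computable_ordinal s \<Longrightarrow> omega1CK \<le>o s"
    using * by blast+
qed

lemma less_omega1CK_computable:
  assumes "\<alpha> <o omega1CK"
  shows "computable_ordinal \<alpha>"
proof -
  have "Well_order \<alpha>"
    using assms unfolding ordLess_def by auto
  then obtain a where a: "a \<in> Field omega1CK" "\<alpha> =o Restr omega1CK (underS omega1CK a)"
    using assms ordLess_iff_ordIso_Restr[OF omega1CK_least(1)] by blast
  let ?s = "Restr omega1CK (underS omega1CK a)"
  have "?s <o omega1CK"
    using a(1) omega1CK_least(1) by (intro underS_Restr_ordLess) auto
  then have "computable_ordinal ?s"
    using omega1CK_least(3)[OF Well_order_Restr[OF omega1CK_least(1)]]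
      not_ordLess_ordLeq[of ?s omega1CK] by blast
  then show ?thesis
    unfolding computable_ordinal_def using ordIso_transitive[OF a(2)] by blast
qed


section \<open>Trees\<close>

definition partial_order_tree :: "'t set \<Rightarrow> 't rel \<Rightarrow> bool" where
  "partial_order_tree T le \<longleftrightarrow>
     partial_order_on T le \<and>
     (\<exists>r\<in>T. \<forall>x\<in>T. (r, x) \<in> le) \<and>
     (\<forall>y\<in>T. finite {x \<in> T. (x, y) \<in> le} \<and> total_on {x \<in> T. (x, y) \<in> le} le)"

text \<open>
  \<^term>\<open>S\<^sup>*\<close> is reflexive on the whole type, hence the restriction to the carrier.
\<close>

definition tree_order :: "'t set \<Rightarrow> 't rel \<Rightarrow> 't rel" where
  "tree_order T S = Restr (S\<^sup>*) T"

definition successor_tree :: "'t set \<Rightarrow> 't rel \<Rightarrow> bool" where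
  "successor_tree T S \<longleftrightarrow> S \<subseteq> T \<times> T \<and> partial_order_tree T (tree_order T S)"


section \<open>Cantor--Bendixson rank\<close>

text \<open>
  Paths start at the root: they are downward closed in the subtree \<open>X\<close>. (Otherwise any node on
  an infinite path would lie on infinitely many, namely its tails.)
\<close>

definition infinite_path :: "'t rel \<Rightarrow> 't set \<Rightarrow> 't set \<Rightarrow> bool" where
  "infinite_path le X P \<longleftrightarrow>
     P \<subseteq> X \<and> infinite P \<and> total_on P le \<and> (\<forall>x\<in>P. \<forall>y\<in>X. (y, x) \<in> le \<longrightarrow> y \<in> P)"

definition derivative :: "'t rel \<Rightarrow> 't set \<Rightarrow> 't set" where
  "derivative le X =
     {x \<in> X. \<exists>P Q. infinite_path le X P \<and> infinite_path le X Q \<and> P \<noteq> Q \<and> x \<in> P \<and> x \<in> Q}"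

text \<open>
  \<open>iter_derivative le T \<alpha>\<close> is the \<open>\<alpha>\<close>-th derivative of \<open>T\<close>. Up to isomorphism, the ordinals
  below \<open>\<alpha>\<close> are the initial segments \<open>Restr \<alpha> (underS \<alpha> x)\<close> for \<open>x \<in> Field \<alpha>\<close>; \<open>\<alpha>\<close> is a
  successor iff it has a greatest element \<open>m\<close>, and then its predecessor is the segment
  below \<open>m\<close>. The value for relations that are not well-orders is irrelevant.
\<close>

definition is_greatest :: "'o rel \<Rightarrow> 'o \<Rightarrow> bool" where
  "is_greatest \<alpha> m \<longleftrightarrow> m \<in> Field \<alpha> \<and> (\<forall>x\<in>Field \<alpha>. (x, m) \<in> \<alpha>)"

function iter_derivative :: "'t rel \<Rightarrow> 't set \<Rightarrow> 'o rel \<Rightarrow> 't set" where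
  "iter_derivative le T \<alpha> =
     (if \<not> Well_order \<alpha> \<or> Field \<alpha> = {} then T
      else if \<exists>m. is_greatest \<alpha> m
      then derivative le (iter_derivative le T (Restr \<alpha> (underS \<alpha> (THE m. is_greatest \<alpha> m))))
      else \<Inter>x\<in>Field \<alpha>. iter_derivative le T (Restr \<alpha> (underS \<alpha> x)))"
  by pat_completeness auto
termination
proof (relation "inv_image ordLess (\<lambda>(le, T, \<alpha>). \<alpha>)", goal_cases)
  case 1
  show ?case by (intro wf_inv_image wf_ordLess)
next
  case (2 le T \<alpha>)
  then have "Well_order \<alpha>" "Field \<alpha> \<noteq> {}" by simp_all
  then show ?case unfolding in_inv_image prod.case by (rule underS_Restr_ordLess)
next
  case (3 le T \<alpha> x)
  then have "Well_order \<alpha>" "Field \<alpha> \<noteq> {}" by simp_all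
  then show ?case unfolding in_inv_image prod.case by (rule underS_Restr_ordLess)
qed

declare iter_derivative.simps [simp del]

text \<open>
  The \<open>(\<alpha>+1)\<close>-st derivative is written as the derivative of the \<open>\<alpha>\<close>-th one. Every ordinal
  below \<open>\<alpha>\<close> is represented on the carrier type of \<open>\<alpha>\<close>, so the quantifier over \<open>\<beta>\<close> misses none.
\<close>

definition has_CB_rank :: "'t set \<Rightarrow> 't rel \<Rightarrow> 'o rel \<Rightarrow> bool" where
  "has_CB_rank T le \<alpha> \<longleftrightarrow>
     Well_order \<alpha> \<and>
     iter_derivative le T \<alpha> = derivative le (iter_derivative le T \<alpha>) \<and>
     (\<forall>\<beta> :: 'o rel. \<beta> <o \<alpha> \<longrightarrow>
        iter_derivative le T \<beta> \<noteq> derivative le (iter_derivative le T \<beta>))"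


section \<open>Automatic structures\<close>

record 'a automaton =
  states :: "nat set"
  init :: nat
  transitions :: "(nat \<times> 'a \<times> nat) set"
  final :: "nat set"

definition finite_automaton :: "'a set \<Rightarrow> 'a automaton \<Rightarrow> bool" where
  "finite_automaton A M \<longleftrightarrow>
     finite (states M) \<and> init M \<in> states M \<and>
     transitions M \<subseteq> states M \<times> A \<times> states M \<and> final M \<subseteq> states M"

fun accepts_from :: "'a automaton \<Rightarrow> nat \<Rightarrow> 'a list \<Rightarrow> bool" where
  "accepts_from M q [] \<longleftrightarrow> q \<in> final M"
| "accepts_from M q (a # w) \<longleftrightarrow> (\<exists>q'. (q, a, q') \<in> transitions M \<and> accepts_from M q' w)"

definition language :: "'a automaton \<Rightarrow> 'a list set" where
  "language M = {w. accepts_from M (init M) w}"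

definition regular :: "'a set \<Rightarrow> 'a list set \<Rightarrow> bool" where
  "regular A L \<longleftrightarrow> (\<exists>M. finite_automaton A M \<and> language M = L)"

text \<open>The padding symbol is \<^term>\<open>None\<close>.\<close>

fun convolution :: "'a list \<Rightarrow> 'a list \<Rightarrow> ('a option \<times> 'a option) list" where
  "convolution [] [] = []"
| "convolution (x # xs) [] = (Some x, None) # convolution xs []"
| "convolution [] (y # ys) = (None, Some y) # convolution [] ys"
| "convolution (x # xs) (y # ys) = (Some x, Some y) # convolution xs ys"

definition padded :: "'a set \<Rightarrow> 'a option set" where
  "padded A = insert None (Some ` A)"

definition regular_rel :: "'a set \<Rightarrow> 'a list rel \<Rightarrow> bool" where
  "regular_rel A R \<longleftrightarrow>
     R \<subseteq> lists A \<times> lists A \<and>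
     regular (padded A \<times> padded A) {convolution u v | u v. (u, v) \<in> R}"

definition automatic :: "'t set \<Rightarrow> 't rel \<Rightarrow> bool" where
  "automatic T S \<longleftrightarrow>
     (\<exists>(A :: nat set) T' S' f.
        finite A \<and> T' \<subseteq> lists A \<and> regular A T' \<and>
        S' \<subseteq> T' \<times> T' \<and> regular_rel A S' \<and>
        bij_betw f T T' \<and> (\<forall>x\<in>T. \<forall>y\<in>T. (x, y) \<in> S \<longleftrightarrow> (f x, f y) \<in> S'))"

end

theory Submission
  imports Defs
begin

text \<open>
  Let \<open>r\<close> be a computable well-order of type \<open>\<alpha>\<close>, decided by a register machine \<open>p\<close>. Build a
  nondeterministic register machine that, holding \<open>x\<close>, climbs an infinite spine and may leave it
  at height \<open>n\<close> by guessing some \<open>y \<le> n\<close>; it then runs \<open>p\<close>, and if \<open>y\<close> is strictly below \<open>x\<close> in \<open>r\<close>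
  it restarts on a spine for \<open>y\<close>, otherwise it gets stuck. Every \<open>y\<close> below \<open>x\<close> is met infinitely often
  along the spine of \<open>x\<close>, so inductively the spine of \<open>x\<close> survives exactly as many derivatives as
  the position of \<open>x\<close> in \<open>r\<close>.

  A node of the tree is a configuration together with the list of all transitions executed so
  far; the list makes predecessors unique. All configurations, reachable or not, are
  admitted, and those that cannot be traced back any further become children of the root. This
  is harmless: away from the spines the machine is deterministic, so an arbitrary configuration
  only adds a single path leading to an honest spine, and its rank is below \<open>\<alpha>\<close>. The root itself lies
  in a perfect subtree, and that subtree is what remains after \<open>\<alpha>\<close> derivatives.
\<close>

section \<open>Regular languages via left quotients\<close>

text \<open>The node set must be regular, and the histories of genuine computations in general are
  not; hence inconsistent histories and unreachable configurations enter the tree. Parents must then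
  be unique for arbitrary configurations, so every operation has to be reversible: registers are
  emptied by unit decrements (the states \<open>Clear\<close> and \<open>Flush\<close>) before
  anything is copied over them. Guesses are bounded by the height so that no register outgrows the
  history, which leaves room to write registers in unary along it. The perfect subtree settles the
  end of the count: with the spines alone, a limit \<alpha> would leave the bare root after \<alpha>
  derivatives, and the rank would be \<alpha>+1. Ranks are computed on configurations, not on nodes:
  the children of a non-root node correspond to the successors of its configuration, so each
  derivative becomes a count of infinite runs. Rank zero is treated apart, since configurations that
  reach no spine take the least element of \<open>r\<close> as their rank.\<close>

definition quot :: "'a list set \<Rightarrow> 'a list \<Rightarrow> 'a list set" where
  "quot L u = {w. u @ w \<in> L}"

text \<open>Myhill-Nerode: the quotients themselves serve as states, renumbered by
  \<open>num\<close> because automaton states are natural numbers. Closure properties then reduce to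
  bounding the number of quotients.\<close>

lemma regular_if_finite_quot:
  assumes LA: "L \<subseteq> lists A" and fin: "finite (quot L ` lists A)"
  shows "regular A L"
proof -
  let ?Q = "quot L ` lists A"
  obtain num :: "'a list set \<Rightarrow> nat" where inj: "inj_on num ?Q"
    using finite_imp_inj_to_nat_seg[OF fin] by blast
  define M where "M = \<lparr>states = num ` ?Q, init = num (quot L []),
    transitions = {(num (quot L u), a, num (quot L (u @ [a]))) | u a. u \<in> lists A \<and> a \<in> A},
    final = num ` {q \<in> ?Q. [] \<in> q}\<rparr>"
  have "finite_automaton A M"
    unfolding finite_automaton_def M_def using fin by (auto intro!: imageI)
  moreover have acc: "accepts_from M (num (quot L u)) w \<longleftrightarrow> u @ w \<in> L" if "u \<in> lists A" for u w
    using that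
  proof (induction w arbitrary: u)
    case Nil
    then have "num (quot L u) \<in> num ` {q \<in> ?Q. [] \<in> q} \<longleftrightarrow> quot L u \<in> {q \<in> ?Q. [] \<in> q}"
      by (intro inj_on_image_mem_iff[OF inj] imageI) auto
    then have "accepts_from M (num (quot L u)) [] \<longleftrightarrow> [] \<in> quot L u"
      using Nil by (simp add: M_def)
    then show ?case by (simp add: quot_def)
  next
    case (Cons a w)
    have shift: "quot L (v @ [a]) = quot L (u @ [a])" if "quot L v = quot L u" for v
    proof -
      have "quot L (x @ [a]) = {w. a # w \<in> quot L x}" for x by (simp add: quot_def)
      then show ?thesis using that by simp
    qed
    have "(num (quot L u), a, q) \<in> transitions M \<longleftrightarrow> a \<in> A \<and> q = num (quot L (u @ [a]))" for q
    proof
      assume "(num (quot L u), a, q) \<in> transitions M"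
      then obtain v where v: "v \<in> lists A" "a \<in> A" "num (quot L u) = num (quot L v)"
          "q = num (quot L (v @ [a]))"
        unfolding M_def by auto
      have "quot L u = quot L v"
        using v(3) by (rule inj_onD[OF inj]) (rule imageI, fact Cons.prems, rule imageI, fact v(1))
      then show "a \<in> A \<and> q = num (quot L (u @ [a]))"
        using v shift[of v] by simp
    next
      assume "a \<in> A \<and> q = num (quot L (u @ [a]))"
      then show "(num (quot L u), a, q) \<in> transitions M"
        unfolding M_def using Cons.prems by auto
    qed
    then have "accepts_from M (num (quot L u)) (a # w) \<longleftrightarrow>
        a \<in> A \<and> accepts_from M (num (quot L (u @ [a]))) w"
      by simp
    also have "\<dots> \<longleftrightarrow> a \<in> A \<and> (u @ [a]) @ w \<in> L"
      using Cons.IH[of "u @ [a]"] Cons.prems by auto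
    also have "\<dots> \<longleftrightarrow> u @ a # w \<in> L"
      using LA by auto
    finally show ?case .
  qed
  have "language M = L"
    using acc[of "[]"] by (auto simp: language_def M_def)
  ultimately show ?thesis unfolding regular_def by blast
qed

text \<open>Subset construction: after \<open>u\<close> only the set of current states matters.
  \<open>X\<close> is inserted because it is what remains for the empty word and need not consist of
  states of \<open>M\<close>.\<close>

lemma accepts_from_quot:
  assumes M: "finite_automaton A M"
  shows "{w. \<exists>q\<in>X. accepts_from M q (u @ w)} \<in> (\<lambda>Y. {w. \<exists>q\<in>Y. accepts_from M q w}) ` insert X (Pow (states M))"
proof (induction u arbitrary: X)
  case Nil
  then show ?case by auto
next
  case (Cons a u)
  let ?Y = "{q'. \<exists>q\<in>X. (q, a, q') \<in> transitions M}"
  have "?Y \<subseteq> states M" using M unfolding finite_automaton_def by blast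
  moreover have "{w. \<exists>q\<in>X. accepts_from M q ((a # u) @ w)} = {w. \<exists>q\<in>?Y. accepts_from M q (u @ w)}"
    by auto
  moreover have "insert ?Y (Pow (states M)) \<subseteq> insert X (Pow (states M))"
    using \<open>?Y \<subseteq> states M\<close> by blast
  ultimately show ?case using subsetD[OF image_mono Cons.IH[of ?Y]] by simp
qed

lemma regular_finite_quot:
  assumes "regular A L"
  shows "L \<subseteq> lists A" and "finite (range (quot L))"
proof -
  obtain M where M: "finite_automaton A M" and L: "language M = L"
    using assms unfolding regular_def by blast
  have "w \<in> lists A" if "accepts_from M q w" for q w
    using that M by (induction w arbitrary: q) (auto simp: finite_automaton_def)
  then show "L \<subseteq> lists A" using L unfolding language_def by auto
  have "quot L u \<in> (\<lambda>Y. {w. \<exists>q\<in>Y. accepts_from M q w}) ` insert {init M} (Pow (states M))" for u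
    using accepts_from_quot[OF M, of "{init M}" u] unfolding quot_def L[symmetric] language_def by simp
  then have "range (quot L) \<subseteq> (\<lambda>Y. {w. \<exists>q\<in>Y. accepts_from M q w}) ` insert {init M} (Pow (states M))"
    by (rule image_subsetI)
  then show "finite (range (quot L))"
    by (rule finite_subset) (use M in \<open>simp add: finite_automaton_def\<close>)
qed

lemma regular_Un:
  assumes "regular A L" "regular A M"
  shows "regular A (L \<union> M)"
proof (rule regular_if_finite_quot)
  show "L \<union> M \<subseteq> lists A" using assms[THEN regular_finite_quot(1)] by (rule Un_least)
  have "quot (L \<union> M) u = quot L u \<union> quot M u" for u
    by (auto simp: quot_def)
  then have "quot (L \<union> M) ` lists A \<subseteq> (\<lambda>(X, Y). X \<union> Y) ` (range (quot L) \<times> range (quot M))"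
    by (auto simp: image_iff)
  then show "finite (quot (L \<union> M) ` lists A)"
    by (rule finite_subset) (use assms[THEN regular_finite_quot(2)] in simp)
qed

lemma regular_Diff:
  assumes "regular A L" "regular A M"
  shows "regular A (L - M)"
proof (rule regular_if_finite_quot)
  show "L - M \<subseteq> lists A" using regular_finite_quot(1)[OF assms(1)] by (rule order_trans[rotated]) simp
  have "quot (L - M) u = quot L u - quot M u" for u
    by (auto simp: quot_def)
  then have "quot (L - M) ` lists A \<subseteq> (\<lambda>(X, Y). X - Y) ` (range (quot L) \<times> range (quot M))"
    by (auto simp: image_iff)
  then show "finite (quot (L - M) ` lists A)"
    by (rule finite_subset) (use assms[THEN regular_finite_quot(2)] in simp)
qed

text \<open>A quotient of the image is a union of images of the quotients by all preimages of the
  word read, hence determined by a subset of the finitely many quotients of \<open>L\<close>. It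
  serves to project convolutions to a component and to pad words.\<close>

lemma regular_map:
  assumes "regular A L" "map f ` L \<subseteq> lists B"
  shows "regular B (map f ` L)"
proof (rule regular_if_finite_quot)
  have "quot (map f ` L) w = \<Union> ((`) (map f) ` quot L ` {u. map f u = w})" for w
    by (auto simp: quot_def map_eq_append_conv append_eq_map_conv image_iff)
  then have "quot (map f ` L) w \<in> (\<lambda>Q. \<Union> ((`) (map f) ` Q)) ` Pow (range (quot L))" for w
    by (rule image_eqI) blast
  then have "quot (map f ` L) ` lists B \<subseteq> (\<lambda>Q. \<Union> ((`) (map f) ` Q)) ` Pow (range (quot L))"
    by (rule image_subsetI)
  then show "finite (quot (map f ` L) ` lists B)"
    by (rule finite_subset) (use regular_finite_quot(2)[OF assms(1)] in simp)
qed (fact assms(2))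

lemma regular_empty: "regular A {}"
  by (rule regular_if_finite_quot) (auto simp: quot_def image_constant_conv)

lemma regular_UN:
  assumes "finite I" "\<And>i. i \<in> I \<Longrightarrow> regular A (L i)"
  shows "regular A (\<Union>i\<in>I. L i)"
  using assms by (induction I rule: finite_induct) (simp_all add: regular_empty regular_Un)

lemma regular_Nil: "regular A {[]}"
proof (rule regular_if_finite_quot)
  have "quot {[]} ` lists A \<subseteq> {{[]}, {}}"
    by (auto simp: quot_def)
  then show "finite (quot {[]} ` lists A)" by (rule finite_subset) simp
qed simp

definition local_language ::
  "'a set \<Rightarrow> ('a \<Rightarrow> bool) \<Rightarrow> ('a \<Rightarrow> 'a \<Rightarrow> bool) \<Rightarrow> ('a \<Rightarrow> bool) \<Rightarrow> ('a \<Rightarrow> bool) \<Rightarrow> 'a list set" where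
  "local_language B F Q G X =
     {w \<in> lists B. w \<noteq> [] \<and> F (hd w) \<and> successively Q w \<and> G (last w) \<and> (\<exists>c\<in>set w. X c)}"

lemma regular_local_language:
  assumes "finite A" "B \<subseteq> A"
  shows "regular A (local_language B F Q G X)"
proof (rule regular_if_finite_quot)
  let ?L = "local_language B F Q G X"
  show "?L \<subseteq> lists A"
    using assms(2) by (auto simp: local_language_def)
  \<comment> \<open>After a nonempty prefix it suffices to remember its last letter \<open>a\<close>
    and one bit \<open>b\<close>, telling whether a letter satisfying \<open>X\<close> has
    occurred.\<close>
  define K where "K = (\<lambda>(a, b). {w \<in> lists B. successively Q (a # w) \<and> G (last (a # w)) \<and> (b \<or> (\<exists>c\<in>set w. X c))})"
  have "quot ?L u \<in> insert ?L (insert {} (K ` (A \<times> UNIV)))" if u: "u \<in> lists A" for u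
  proof (cases "u \<in> lists B \<and> u \<noteq> [] \<and> F (hd u) \<and> successively Q u")
    case True
    then have "u @ w \<in> ?L \<longleftrightarrow> w \<in> K (last u, \<exists>c\<in>set u. X c)" for w
      by (cases "w = []") (auto simp: K_def local_language_def successively_append_iff successively_Cons)
    then have "quot ?L u = K (last u, \<exists>c\<in>set u. X c)"
      by (auto simp: quot_def)
    moreover have "last u \<in> A" using True u by auto
    ultimately show ?thesis by blast
  next
    case False
    show ?thesis
    proof (cases "u = []")
      case True
      then show ?thesis by (simp add: quot_def)
    next
      case nonempty: False
      then have "quot ?L u = {}" using False
        by (auto simp: quot_def local_language_def successively_append_iff)
      then show ?thesis by simp
    qed
  qed
  then have "quot ?L ` lists A \<subseteq> insert ?L (insert {} (K ` (A \<times> UNIV)))"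
    by (rule image_subsetI)
  then show "finite (quot ?L ` lists A)"
    by (rule finite_subset) (use assms(1) in simp)
qed

section \<open>Convolutions read position by position\<close>

definition pad_nth :: "'a list \<Rightarrow> nat \<Rightarrow> 'a option" where
  "pad_nth u j = (if j < length u then Some (u ! j) else None)"

lemma pad_nth_simps [simp]:
  "pad_nth [] j = None"
  "pad_nth (a # u) 0 = Some a"
  "pad_nth (a # u) (Suc j) = pad_nth u j"
  by (simp_all add: pad_nth_def)

lemma length_convolution [simp]: "length (convolution u v) = max (length u) (length v)"
  by (induction u v rule: convolution.induct) auto

lemma convolution_Nil: "convolution [] v = map (\<lambda>a. (None, Some a)) v"
  by (induction v) auto

lemma map_snd_convolution: "length u \<le> length v \<Longrightarrow> map (the \<circ> snd) (convolution u v) = v"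
  by (induction u v rule: convolution.induct) (auto simp: convolution_Nil)

lemma nth_convolution:
  "j < max (length u) (length v) \<Longrightarrow> convolution u v ! j = (pad_nth u j, pad_nth v j)"
proof (induction u v arbitrary: j rule: convolution.induct)
  case (2 x xs) then show ?case by (cases j) auto
next
  case (3 y ys) then show ?case by (cases j) auto
next
  case (4 x xs y ys) then show ?case by (cases j) auto
qed simp

section \<open>Trees with a distinguished root\<close>

locale rooted_forest =
  fixes T :: "'t set" and \<epsilon> :: 't and E :: "'t rel" and depth :: "'t \<Rightarrow> nat"
  assumes root_in_T: "\<epsilon> \<in> T"
    and E_nodes: "E \<subseteq> (T - {\<epsilon>}) \<times> (T - {\<epsilon>})"
    and E_depth: "(u, v) \<in> E \<Longrightarrow> depth v = Suc (depth u)"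
    and E_parent: "(u, w) \<in> E \<Longrightarrow> (v, w) \<in> E \<Longrightarrow> u = v"
begin

definition S :: "'t rel" where
  "S = {\<epsilon>} \<times> (T - {\<epsilon>} - Range E) \<union> E"

abbreviation le :: "'t rel" where
  "le \<equiv> tree_order T S"

lemma rtrancl_E_depth: "(u, v) \<in> E\<^sup>* \<Longrightarrow> depth u \<le> depth v \<and> (depth u = depth v \<longrightarrow> u = v)"
proof (induction rule: rtrancl_induct)
  case (step v w)
  then show ?case using E_depth[OF step.hyps(2)] by simp
qed simp

lemma rtrancl_E_nodes: "(u, v) \<in> E\<^sup>* \<Longrightarrow> u \<noteq> v \<Longrightarrow> u \<in> T - {\<epsilon>} \<and> v \<in> T - {\<epsilon>}"
  by (induction rule: rtrancl_induct) (use E_nodes in auto)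

lemma le_iff: "(u, v) \<in> le \<longleftrightarrow> u \<in> T \<and> v \<in> T \<and> (u = \<epsilon> \<or> (u, v) \<in> E\<^sup>*)"
proof -
  have "u = v \<or> u = \<epsilon> \<and> v \<noteq> \<epsilon> \<or> (u, v) \<in> E\<^sup>*" if "(u, v) \<in> S\<^sup>*"
    using that
  proof (induction rule: rtrancl_induct)
    case base
    then show ?case by simp
  next
    case (step v w)
    then consider "v = \<epsilon>" "w \<noteq> \<epsilon>" | "(v, w) \<in> E" unfolding S_def by blast
    then show ?case
    proof cases
      case 1
      then show ?thesis using step.IH rtrancl_E_nodes[of u \<epsilon>] by blast
    next
      case 2
      moreover have "w \<noteq> \<epsilon>" using 2 E_nodes by blast
      ultimately show ?thesis using step.IH by (meson r_into_rtrancl rtrancl_into_rtrancl)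
    qed
  qed
  moreover have "E\<^sup>* \<subseteq> S\<^sup>*" by (rule rtrancl_mono) (simp add: S_def)
  moreover have "(\<epsilon>, v) \<in> S\<^sup>*" if "v \<in> T"
    using that
  proof (induction "depth v" arbitrary: v rule: less_induct)
    case less
    show ?case
    proof (cases "v \<in> Range E")
      case True
      then obtain u where u: "(u, v) \<in> E" by blast
      then have "(\<epsilon>, u) \<in> S\<^sup>*" using less(1)[of u] E_depth E_nodes by auto
      moreover have "(u, v) \<in> S" using u by (simp add: S_def)
      ultimately show ?thesis by (rule rtrancl_into_rtrancl)
    next
      case False
      then show ?thesis using less(2) by (cases "v = \<epsilon>") (auto simp: S_def)
    qed
  qed
  ultimately show ?thesis unfolding tree_order_def by auto
qed

lemma below_comparable:
  assumes "(u, w) \<in> E\<^sup>*" "(v, w) \<in> E\<^sup>*"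
  shows "(u, v) \<in> E\<^sup>* \<or> (v, u) \<in> E\<^sup>*"
proof -
  have "single_valued (E\<inverse>)"
    using E_parent by (auto simp: single_valued_def)
  from single_valued_confluent[OF this, of w u v] assms show ?thesis
    by (auto simp: rtrancl_converse)
qed

lemma finite_below: "finite {x. (x, y) \<in> E\<^sup>*}"
proof (induction "depth y" arbitrary: y rule: less_induct)
  case less
  show ?case
  proof (cases "\<exists>z. (z, y) \<in> E")
    case True
    then obtain z where z: "(z, y) \<in> E" by blast
    have "{x. (x, y) \<in> E\<^sup>*} \<subseteq> insert y {x. (x, z) \<in> E\<^sup>*}"
      using E_parent[OF z] by (auto elim: rtranclE)
    moreover have "finite {x. (x, z) \<in> E\<^sup>*}" using less E_depth[OF z] by simp
    ultimately show ?thesis by (meson finite.insertI finite_subset)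
  next
    case False
    then have "{x. (x, y) \<in> E\<^sup>*} \<subseteq> {y}" by (auto elim: rtranclE)
    then show ?thesis by (rule finite_subset) simp
  qed
qed

lemma finite_le: "finite {x. (x, y) \<in> le}"
  by (rule finite_subset[of _ "insert \<epsilon> {x. (x, y) \<in> E\<^sup>*}"]) (auto simp: le_iff finite_below)

lemma le_comparable: "(u, w) \<in> le \<Longrightarrow> (v, w) \<in> le \<Longrightarrow> (u, v) \<in> le \<or> (v, u) \<in> le"
  using below_comparable by (auto simp: le_iff)

lemma successor_tree: "successor_tree T S"
proof -
  have "partial_order_on T le"
    unfolding partial_order_on_def preorder_on_def
  proof (intro conjI)
    show "refl_on T le" by (auto simp: refl_on_def le_iff)
    show "trans le"
      using rtrancl_E_nodes[of _ \<epsilon>] by (auto simp: trans_def le_iff intro: rtrancl_trans)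
    show "antisym le"
      using rtrancl_E_nodes[of _ \<epsilon>] rtrancl_E_depth by (auto simp: antisym_def le_iff) (meson le_antisym)
    show "le \<subseteq> T \<times> T" by (auto simp: le_iff)
  qed
  moreover have "\<exists>r\<in>T. \<forall>x\<in>T. (r, x) \<in> le"
    using root_in_T by (auto simp: le_iff)
  moreover have "finite {x \<in> T. (x, y) \<in> le}" for y
    by (rule finite_subset[OF _ finite_le[of y]]) auto
  moreover have "total_on {x \<in> T. (x, y) \<in> le} le" for y
    using le_comparable by (auto simp: total_on_def)
  ultimately show ?thesis
    unfolding successor_tree_def partial_order_tree_def
    using root_in_T E_nodes by (auto simp: S_def)
qed

definition closed_below :: "'t set \<Rightarrow> bool" where
  "closed_below X \<longleftrightarrow> \<epsilon> \<in> X \<and> X \<subseteq> T \<and> (\<forall>(u, v)\<in>E. v \<in> X \<longrightarrow> u \<in> X)"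

lemma closed_belowD:
  assumes "closed_below X" "v \<in> X" "(u, v) \<in> le"
  shows "u \<in> X"
proof -
  have "(u, v) \<in> E\<^sup>* \<Longrightarrow> u \<in> X"
    by (induction rule: converse_rtrancl_induct) (use assms in \<open>auto simp: closed_below_def\<close>)
  then show ?thesis using assms by (auto simp: le_iff closed_below_def)
qed

definition chain :: "'t set \<Rightarrow> 't \<Rightarrow> (nat \<Rightarrow> 't) \<Rightarrow> bool" where
  "chain X w f \<longleftrightarrow> f 0 = w \<and> (\<forall>i. f i \<in> X \<and> (f i, f (Suc i)) \<in> E)"

definition chain_path :: "(nat \<Rightarrow> 't) \<Rightarrow> 't set" where
  "chain_path f = {x. \<exists>i. (x, f i) \<in> le}"

lemma chain_depth:
  assumes "chain X w f"
  shows "depth (f i) = depth w + i"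
proof (induction i)
  case 0
  then show ?case using assms unfolding chain_def by simp
next
  case (Suc i)
  have "depth (f (Suc i)) = Suc (depth (f i))"
    using assms unfolding chain_def by (intro E_depth) blast
  then show ?case using Suc by simp
qed

lemma chain_le:
  assumes "chain X w f" "i \<le> j"
  shows "(f i, f j) \<in> le"
  using assms(2)
proof (induction j rule: dec_induct)
  case base
  then show ?case using assms E_nodes unfolding chain_def le_iff by blast
next
  case (step j)
  then have "(f j, f (Suc j)) \<in> E" using assms unfolding chain_def by blast
  moreover have "f (Suc j) \<in> T" using calculation E_nodes by blast
  ultimately show ?case using step.IH by (auto simp: le_iff intro: rtrancl_into_rtrancl)
qed

lemma chain_path_infinite_path:
  assumes X: "closed_below X" and f: "chain X w f"
  shows "infinite_path le X (chain_path f)"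
  unfolding infinite_path_def
proof (intro conjI ballI impI)
  show "chain_path f \<subseteq> X"
    using closed_belowD[OF X] f by (auto simp: chain_path_def chain_def)
  have "inj f" using chain_depth[OF f] by (metis add_left_cancel injI)
  then have "infinite (range f)" using finite_imageD infinite_UNIV_nat by blast
  moreover have "range f \<subseteq> chain_path f"
    using chain_le[OF f] by (auto simp: chain_path_def)
  ultimately show "infinite (chain_path f)" using finite_subset by blast
  have trans: "(x, y) \<in> le \<Longrightarrow> (y, z) \<in> le \<Longrightarrow> (x, z) \<in> le" for x y z
    using rtrancl_E_nodes[of _ \<epsilon>] by (auto simp: le_iff intro: rtrancl_trans)
  show "total_on (chain_path f) le"
  proof (rule total_onI)
    fix x y assume "x \<in> chain_path f" "y \<in> chain_path f"
    then obtain i j where "(x, f i) \<in> le" "(y, f j) \<in> le" by (auto simp: chain_path_def)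
    then have "(x, f (max i j)) \<in> le" "(y, f (max i j)) \<in> le"
      using chain_le[OF f] trans by (meson max.cobounded1 max.cobounded2)+
    then show "(x, y) \<in> le \<or> (y, x) \<in> le" by (rule le_comparable)
  qed
  show "y \<in> chain_path f" if "x \<in> chain_path f" "(y, x) \<in> le" for x y
    using that trans by (auto simp: chain_path_def)
qed

text \<open>Only finitely many nodes lie below a given one, so an infinite linearly ordered set
  continues above each of its nodes, and downward closure lets it continue by an
  \<open>E\<close>-step.\<close>

lemma chain_in_path:
  assumes X: "closed_below X" and P: "infinite_path le X P" and w: "w \<in> P" "w \<noteq> \<epsilon>"
  shows "\<exists>f. chain X w f \<and> P = chain_path f"
proof -
  have PX: "P \<subseteq> X" and inf: "infinite P" and tot: "total_on P le"
    and down: "\<And>x y. x \<in> P \<Longrightarrow> y \<in> X \<Longrightarrow> (y, x) \<in> le \<Longrightarrow> y \<in> P"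
    using P unfolding infinite_path_def by blast+
  have PT: "P \<subseteq> T" using PX X unfolding closed_below_def by blast
  have ext: "\<exists>v'\<in>P - {\<epsilon>}. (v, v') \<in> E" if v: "v \<in> P - {\<epsilon>}" for v
  proof -
    obtain z where z: "z \<in> P" "(z, v) \<notin> le"
      using inf finite_subset[OF _ finite_le[of v], of P] by blast
    have "z \<noteq> v" using z PT by (auto simp: le_iff)
    then have "(v, z) \<in> le" using tot z v unfolding total_on_def by blast
    then have "(v, z) \<in> E\<^sup>*" using v by (simp add: le_iff)
    then obtain v' where v': "(v, v') \<in> E" "(v', z) \<in> E\<^sup>*"
      using \<open>z \<noteq> v\<close> by (auto elim: converse_rtranclE)
    then have "(v', z) \<in> le" using E_nodes z PT by (auto simp: le_iff)
    then have "v' \<in> P" using down[of z v'] closed_belowD[OF X, of z v'] z PX by blast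
    then show ?thesis using v' E_nodes by blast
  qed
  have "\<exists>f. f 0 = w \<and> (\<forall>n. f n \<in> P - {\<epsilon>} \<and> (f n, f (Suc n)) \<in> E)"
  proof -
    have "\<exists>f. \<forall>n. (f n \<in> P - {\<epsilon>} \<and> (n = 0 \<longrightarrow> f n = w)) \<and> (f n, f (Suc n)) \<in> E"
      using w ext by (intro dependent_nat_choice) auto
    then show ?thesis by blast
  qed
  then obtain f where f: "f 0 = w" "\<And>n. f n \<in> P - {\<epsilon>}" "\<And>n. (f n, f (Suc n)) \<in> E" by blast
  then have ch: "chain X w f" using PX unfolding chain_def by blast
  have "P = chain_path f"
  proof
    show "chain_path f \<subseteq> P"
      using f(2) PX closed_belowD[OF X] down unfolding chain_path_def by blast
    show "P \<subseteq> chain_path f"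
    proof
      fix z assume z: "z \<in> P"
      \<comment> \<open>The node \<open>f (Suc (depth z))\<close> is deeper than \<open>z\<close>,
        so of two comparable nodes it must be the upper one.\<close>
      have "z = f (Suc (depth z)) \<or> (z, f (Suc (depth z))) \<in> le \<or> (f (Suc (depth z)), z) \<in> le"
        using tot z f(2) unfolding total_on_def by blast
      moreover have "(f (Suc (depth z)), z) \<notin> E\<^sup>*"
        using rtrancl_E_depth[of "f (Suc (depth z))" z] chain_depth[OF ch, of "Suc (depth z)"] by auto
      ultimately have "(z, f (Suc (depth z))) \<in> le"
        using f(2)[of "Suc (depth z)"] by (auto simp: le_iff)
      then show "z \<in> chain_path f" unfolding chain_path_def by blast
    qed
  qed
  with ch show ?thesis by blast
qed

text \<open>Nodes of equal index have equal depth, and both lie below \<open>g (max i j)\<close>;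
  comparable nodes of equal depth coincide.\<close>

lemma chain_path_inj:
  assumes f: "chain X w f" and g: "chain X w g" and eq: "chain_path f = chain_path g" and w: "w \<noteq> \<epsilon>"
  shows "f = g"
proof
  fix i
  have "f i \<in> chain_path f" using chain_le[OF f, of i i] unfolding chain_path_def by blast
  then obtain j where j: "(f i, g j) \<in> le" using eq unfolding chain_path_def by blast
  let ?k = "max i j"
  have ne: "f i \<noteq> \<epsilon>" "g i \<noteq> \<epsilon>" using f g E_nodes unfolding chain_def by blast+
  have "(f i, g j) \<in> E\<^sup>*" "(g j, g ?k) \<in> E\<^sup>*"
    using j ne chain_le[OF g, of j ?k] g E_nodes unfolding chain_def le_iff by auto
  then have "(f i, g ?k) \<in> E\<^sup>*" by simp
  moreover have "(g i, g ?k) \<in> E\<^sup>*" using chain_le[OF g, of i ?k] ne by (simp add: le_iff)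
  ultimately have "(f i, g i) \<in> E\<^sup>* \<or> (g i, f i) \<in> E\<^sup>*" by (rule below_comparable)
  then show "f i = g i"
    using rtrancl_E_depth chain_depth[OF f, of i] chain_depth[OF g, of i] by metis
qed

text \<open>The part of a path below \<open>w\<close> is determined by \<open>w\<close>, so paths
  through \<open>w\<close> differ only in their chains from \<open>w\<close> on. The root is
  excluded because its edges do not belong to \<open>E\<close>.\<close>

lemma derivative_iff:
  assumes X: "closed_below X" and w: "w \<noteq> \<epsilon>"
  shows "w \<in> derivative le X \<longleftrightarrow> (\<exists>f g. chain X w f \<and> chain X w g \<and> f \<noteq> g)"
proof
  assume "w \<in> derivative le X"
  then obtain P Q where "infinite_path le X P" "infinite_path le X Q" "P \<noteq> Q" "w \<in> P" "w \<in> Q"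
    unfolding derivative_def by blast
  then show "\<exists>f g. chain X w f \<and> chain X w g \<and> f \<noteq> g"
    using chain_in_path[OF X _ _ w] by metis
next
  assume "\<exists>f g. chain X w f \<and> chain X w g \<and> f \<noteq> g"
  then obtain f g where fg: "chain X w f" "chain X w g" "f \<noteq> g" by blast
  have "w \<in> chain_path h" if "chain X w h" for h
    using chain_le[OF that, of 0 0] that unfolding chain_path_def chain_def by auto
  moreover have "w \<in> X" using fg unfolding chain_def by blast
  ultimately show "w \<in> derivative le X"
    unfolding derivative_def using chain_path_infinite_path[OF X] chain_path_inj[OF fg(1,2) _ w] fg by blast
qed

lemma root_in_derivative:
  assumes X: "closed_below X" and w: "w \<in> derivative le X"
  shows "\<epsilon> \<in> derivative le X"
proof -
  have "\<epsilon> \<in> P" if "infinite_path le X P" "w \<in> P" for P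
  proof -
    have "w \<in> T" using that X unfolding infinite_path_def closed_below_def by blast
    then have "(\<epsilon>, w) \<in> le" by (simp add: le_iff root_in_T)
    then show ?thesis using that X unfolding infinite_path_def closed_below_def by blast
  qed
  then show ?thesis using w X unfolding derivative_def closed_below_def by blast
qed

end

section \<open>Derivatives computed on configurations\<close>

definition infinite_run :: "'c rel \<Rightarrow> 'c set \<Rightarrow> 'c \<Rightarrow> (nat \<Rightarrow> 'c) \<Rightarrow> bool" where
  "infinite_run stp L c f \<longleftrightarrow> f 0 = c \<and> (\<forall>i. f i \<in> L \<and> (f i, f (Suc i)) \<in> stp)"

lemma infinite_run_mono: "infinite_run stp L c f \<Longrightarrow> L \<subseteq> L' \<Longrightarrow> infinite_run stp L' c f"
  unfolding infinite_run_def by blast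

lemma infinite_run_Cons:
  assumes "c \<in> L" "(c, c') \<in> stp" "infinite_run stp L c' f"
  shows "infinite_run stp L c (case_nat c f)"
  using assms unfolding infinite_run_def by (auto split: nat.split)

text \<open>\<open>conf\<close> acts as a covering map: above non-root nodes, steps of
  configurations lift uniquely to edges. The nodes over \<open>kern\<close> form the perfect part
  that no derivative touches.\<close>

locale configured_forest = rooted_forest T \<epsilon> E depth
  for T :: "'t set" and \<epsilon> E depth +
  fixes conf :: "'t \<Rightarrow> 'c" and stp :: "'c rel" and kern :: "'c set"
  assumes E_stp: "(u, v) \<in> E \<Longrightarrow> (conf u, conf v) \<in> stp"
    and stp_E: "u \<in> T - {\<epsilon>} \<Longrightarrow> (conf u, c) \<in> stp \<Longrightarrow> \<exists>v. (u, v) \<in> E \<and> conf v = c"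
    and conf_sibling: "(u, v) \<in> E \<Longrightarrow> (u, v') \<in> E \<Longrightarrow> conf v = conf v' \<Longrightarrow> v = v'"
    and kern_node: "\<exists>w\<in>T - {\<epsilon>}. conf w \<in> kern"
    and kern_two: "c \<in> kern \<Longrightarrow> \<exists>c1\<in>kern. \<exists>c2\<in>kern. c1 \<noteq> c2 \<and> (c, c1) \<in> stp \<and> (c, c2) \<in> stp"
    and kern_back: "(c, c') \<in> stp \<Longrightarrow> c' \<in> kern \<Longrightarrow> c \<in> kern"
begin

abbreviation run :: "'c set \<Rightarrow> 'c \<Rightarrow> (nat \<Rightarrow> 'c) \<Rightarrow> bool" where
  "run \<equiv> infinite_run stp"

text \<open>The root is added whatever its configuration: \<open>conf\<close> carries no information
  there, and \<open>kern_node\<close> lets the root survive every derivative.\<close>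

definition nodes :: "'c set \<Rightarrow> 't set" where
  "nodes L = insert \<epsilon> {w \<in> T. conf w \<in> L}"

lemma closed_below_nodes:
  assumes "\<And>c c'. (c, c') \<in> stp \<Longrightarrow> c' \<in> L \<Longrightarrow> c \<in> L"
  shows "closed_below (nodes L)"
  using assms E_nodes E_stp root_in_T unfolding closed_below_def nodes_def by blast

lemma chain_of_run:
  assumes w: "w \<in> T - {\<epsilon>}" and f: "run L (conf w) f"
  shows "\<exists>g. chain (nodes L) w g \<and> conf \<circ> g = f"
proof -
  have "\<exists>g. \<forall>n. (g n \<in> T - {\<epsilon>} \<and> conf (g n) = f n \<and> (n = 0 \<longrightarrow> g n = w)) \<and> (g n, g (Suc n)) \<in> E"
  proof (rule dependent_nat_choice)
    show "\<exists>x. x \<in> T - {\<epsilon>} \<and> conf x = f 0 \<and> (0 = (0::nat) \<longrightarrow> x = w)"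
      using w f unfolding infinite_run_def by auto
  next
    fix x and n :: nat
    assume "x \<in> T - {\<epsilon>} \<and> conf x = f n \<and> (n = 0 \<longrightarrow> x = w)"
    then show "\<exists>y. (y \<in> T - {\<epsilon>} \<and> conf y = f (Suc n) \<and> (Suc n = 0 \<longrightarrow> y = w)) \<and> (x, y) \<in> E"
      using stp_E[of x "f (Suc n)"] f E_nodes unfolding infinite_run_def by auto
  qed
  then obtain g where g: "\<And>n. g n \<in> T - {\<epsilon>}" "\<And>n. conf (g n) = f n" "g 0 = w" "\<And>n. (g n, g (Suc n)) \<in> E"
    by blast
  then have "chain (nodes L) w g" using f unfolding chain_def nodes_def infinite_run_def by auto
  moreover have "conf \<circ> g = f" using g(2) by auto
  ultimately show ?thesis by blast
qed

lemma run_of_chain: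
  assumes "chain (nodes L) w g"
  shows "run L (conf w) (conf \<circ> g)"
proof -
  have "g i \<noteq> \<epsilon>" for i using assms E_nodes unfolding chain_def by blast
  then show ?thesis using assms E_stp unfolding infinite_run_def chain_def nodes_def by auto
qed

lemma chain_conf_inj:
  assumes "chain X w f" "chain X w g" "conf \<circ> f = conf \<circ> g"
  shows "f = g"
proof
  fix i
  show "f i = g i"
  proof (induction i)
    case 0
    then show ?case using assms unfolding chain_def by simp
  next
    case (Suc i)
    then show ?case
      using assms conf_sibling[of "f i" "f (Suc i)" "g (Suc i)"] unfolding chain_def comp_def by metis
  qed
qed

lemma derivative_nodes_iff:
  assumes L: "\<And>c c'. (c, c') \<in> stp \<Longrightarrow> c' \<in> L \<Longrightarrow> c \<in> L" and w: "w \<in> T - {\<epsilon>}"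
  shows "w \<in> derivative le (nodes L) \<longleftrightarrow> (\<exists>f g. run L (conf w) f \<and> run L (conf w) g \<and> f \<noteq> g)"
proof -
  have "w \<in> derivative le (nodes L) \<longleftrightarrow> (\<exists>f g. chain (nodes L) w f \<and> chain (nodes L) w g \<and> f \<noteq> g)"
    using derivative_iff[OF closed_below_nodes[of L]] L w by blast
  also have "\<dots> \<longleftrightarrow> (\<exists>f g. run L (conf w) f \<and> run L (conf w) g \<and> f \<noteq> g)"
  proof
    assume "\<exists>f g. chain (nodes L) w f \<and> chain (nodes L) w g \<and> f \<noteq> g"
    then show "\<exists>f g. run L (conf w) f \<and> run L (conf w) g \<and> f \<noteq> g"
      using run_of_chain chain_conf_inj by blast
  next
    assume "\<exists>f g. run L (conf w) f \<and> run L (conf w) g \<and> f \<noteq> g"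
    then obtain f g where fg: "run L (conf w) f" "run L (conf w) g" "f \<noteq> g" by blast
    obtain f' where "chain (nodes L) w f'" "conf \<circ> f' = f" using chain_of_run[OF w fg(1)] by blast
    moreover obtain g' where "chain (nodes L) w g'" "conf \<circ> g' = g" using chain_of_run[OF w fg(2)] by blast
    ultimately show "\<exists>f g. chain (nodes L) w f \<and> chain (nodes L) w g \<and> f \<noteq> g" using fg(3) by blast
  qed
  finally show ?thesis .
qed

lemma kern_run:
  assumes "c \<in> kern"
  shows "\<exists>f. run kern c f"
proof -
  have "\<exists>f. \<forall>n. (f n \<in> kern \<and> (n = 0 \<longrightarrow> f n = c)) \<and> (f n, f (Suc n)) \<in> stp"
  proof (rule dependent_nat_choice)
    show "\<exists>x. x \<in> kern \<and> (0 = (0::nat) \<longrightarrow> x = c)" using assms by blast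
    show "\<exists>y. (y \<in> kern \<and> (Suc n = 0 \<longrightarrow> y = c)) \<and> (x, y) \<in> stp"
      if "x \<in> kern \<and> (n = 0 \<longrightarrow> x = c)" for x n
      using kern_two[of x] that by auto
  qed
  then show ?thesis unfolding infinite_run_def by blast
qed

lemma kern_two_runs:
  assumes "c \<in> kern"
  shows "\<exists>f g. run kern c f \<and> run kern c g \<and> f \<noteq> g"
proof -
  obtain c1 c2 where c: "c1 \<in> kern" "c2 \<in> kern" "c1 \<noteq> c2" "(c, c1) \<in> stp" "(c, c2) \<in> stp"
    using kern_two[OF assms] by blast
  obtain f g where fg: "run kern c1 f" "run kern c2 g" using c kern_run by blast
  have "case_nat c f \<noteq> case_nat c g"
    using fg c(3) unfolding infinite_run_def by (metis old.nat.simps(5))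
  then show ?thesis using infinite_run_Cons[OF assms] c fg by blast
qed

text \<open>Whether a non-root node survives depends only on its configuration. Members of
  \<open>kern\<close> have two runs inside \<open>kern\<close>, hence inside every larger set, so
  only the other configurations have to be examined.\<close>

lemma derivative_nodes:
  assumes L: "\<And>c c'. (c, c') \<in> stp \<Longrightarrow> c' \<in> L \<Longrightarrow> c \<in> L" and "kern \<subseteq> L" "kern \<subseteq> L'"
    and step: "\<And>c. c \<notin> kern \<Longrightarrow> c \<in> L' \<longleftrightarrow> (\<exists>f g. run L c f \<and> run L c g \<and> f \<noteq> g)"
  shows "derivative le (nodes L) = nodes L'"
proof -
  have "(\<exists>f g. run L c f \<and> run L c g \<and> f \<noteq> g)" if "c \<in> kern" for c
    using kern_two_runs[OF that] infinite_run_mono[OF _ \<open>kern \<subseteq> L\<close>] by blast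
  then have *: "w \<in> derivative le (nodes L) \<longleftrightarrow> conf w \<in> L'" if "w \<in> T - {\<epsilon>}" for w
    using derivative_nodes_iff[OF L that] step[of "conf w"] \<open>kern \<subseteq> L'\<close>
    by (cases "conf w \<in> kern") auto
  obtain w where w: "w \<in> T - {\<epsilon>}" "conf w \<in> kern" using kern_node by blast
  then have "\<epsilon> \<in> derivative le (nodes L)"
    using root_in_derivative[OF closed_below_nodes[of L]] L * \<open>kern \<subseteq> L'\<close> by blast
  moreover have "derivative le (nodes L) \<subseteq> T"
    using root_in_T unfolding derivative_def nodes_def by blast
  ultimately show ?thesis using * unfolding nodes_def by blast
qed

lemma derivative_kern: "derivative le (nodes kern) = nodes kern"
  by (rule derivative_nodes) (auto simp: infinite_run_def dest: kern_back)

end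

text \<open>These conditions make a configuration outside \<open>kern\<close> last exactly as long
  as its rank: it still branches at every threshold below its rank, and no longer at the rank
  itself.\<close>

locale ranked_forest = configured_forest T \<epsilon> E depth conf stp kern
  for T :: "'t set" and \<epsilon> E depth and conf :: "'t \<Rightarrow> 'c" and stp kern +
  fixes r :: "'r rel" and \<rho> :: "'c \<Rightarrow> 'r"
  assumes wo: "Well_order r"
    and rank_Field: "c \<notin> kern \<Longrightarrow> \<rho> c \<in> Field r"
    and rank_step: "(c, c') \<in> stp \<Longrightarrow> c \<notin> kern \<Longrightarrow> (\<rho> c', \<rho> c) \<in> r"
    and rank_two_runs: "c \<notin> kern \<Longrightarrow> (x, \<rho> c) \<in> r \<Longrightarrow> x \<noteq> \<rho> c \<Longrightarrow>
      \<exists>f g. run {c. (x, \<rho> c) \<in> r} c f \<and> run {c. (x, \<rho> c) \<in> r} c g \<and> f \<noteq> g"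
    and rank_one_run: "c \<notin> kern \<Longrightarrow> run {c'. (\<rho> c, \<rho> c') \<in> r} c f \<Longrightarrow>
      run {c'. (\<rho> c, \<rho> c') \<in> r} c g \<Longrightarrow> f = g"
    and rank_surj: "x \<in> Field r \<Longrightarrow> \<exists>w\<in>T - {\<epsilon>}. conf w \<notin> kern \<and> \<rho> (conf w) = x"
begin

text \<open>
  Up to isomorphism the ordinals below \<open>r\<close> are its initial segments \<open>I\<close>; the nodes surviving \<open>I\<close>
  derivatives turn out to be those with configuration in \<open>layer I\<close>.
\<close>

definition layer :: "'r set \<Rightarrow> 'c set" where
  "layer I = {c. c \<in> kern \<or> \<rho> c \<notin> I}"

lemma order_facts:
  "trans r" "antisym r" "\<And>x. x \<in> Field r \<Longrightarrow> (x, x) \<in> r"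
  "\<And>x y. x \<in> Field r \<Longrightarrow> y \<in> Field r \<Longrightarrow> (x, y) \<in> r \<or> (y, x) \<in> r"
proof -
  show "trans r" "antisym r" using wo by (simp_all add: order_on_defs)
  have "refl_on (Field r) r" "total_on (Field r) r" using wo by (simp_all add: order_on_defs)
  then show "(x, x) \<in> r" "y \<in> Field r \<Longrightarrow> (x, y) \<in> r \<or> (y, x) \<in> r"
    if "x \<in> Field r" for x y
    using that by (cases "x = y"; auto simp: refl_on_def total_on_def)+
qed

text \<open>Outside \<open>kern\<close>, \<open>layer (underS r x)\<close> holds the ranks from
  \<open>x\<close> on. Those above \<open>x\<close> branch by \<open>rank_two_runs\<close>, rank
  \<open>x\<close> does not by \<open>rank_one_run\<close>. The layer is closed under predecessors
  since ranks never increase along steps.\<close>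

lemma derivative_layer:
  assumes x: "x \<in> Field r"
  shows "derivative le (nodes (layer (underS r x))) = nodes (layer (under r x))"
proof (rule derivative_nodes)
  let ?L = "layer (underS r x)"
  have L: "c \<in> ?L \<longleftrightarrow> (x, \<rho> c) \<in> r" if "c \<notin> kern" for c
    using that order_facts(3,4)[OF x] antisymD[OF order_facts(2), of x "\<rho> c"] rank_Field[OF that]
    unfolding layer_def underS_def by auto
  show "c \<in> ?L" if "(c, c') \<in> stp" "c' \<in> ?L" for c c'
  proof (cases "c \<in> kern")
    case True
    then show ?thesis by (simp add: layer_def)
  next
    case False
    then have "c' \<notin> kern" using that kern_back by blast
    then show ?thesis using L that False rank_step order_facts(1) by (meson transD)
  qed
  show "kern \<subseteq> ?L" "kern \<subseteq> layer (under r x)" unfolding layer_def by auto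
  fix c assume c: "c \<notin> kern"
  have not_kern: "f i \<notin> kern" if "run X c f" for X f i
    using that c by (induction i) (auto simp: infinite_run_def dest: kern_back)
  have run_L: "run ?L c f \<longleftrightarrow> run {c. (x, \<rho> c) \<in> r} c f" for f
    using not_kern[of ?L f] not_kern[of "{c. (x, \<rho> c) \<in> r}" f] L unfolding infinite_run_def by blast
  show "c \<in> layer (under r x) \<longleftrightarrow> (\<exists>f g. run ?L c f \<and> run ?L c g \<and> f \<noteq> g)"
  proof
    assume "c \<in> layer (under r x)"
    then have "(\<rho> c, x) \<notin> r" using c unfolding layer_def under_def by auto
    then have "(x, \<rho> c) \<in> r" "x \<noteq> \<rho> c" using order_facts x rank_Field[OF c] by blast+
    then show "\<exists>f g. run ?L c f \<and> run ?L c g \<and> f \<noteq> g" using rank_two_runs[OF c] run_L by blast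
  next
    assume "\<exists>f g. run ?L c f \<and> run ?L c g \<and> f \<noteq> g"
    then obtain f g where fg: "run {c. (x, \<rho> c) \<in> r} c f" "run {c. (x, \<rho> c) \<in> r} c g" "f \<noteq> g"
      using run_L by blast
    then have "(x, \<rho> c) \<in> r" unfolding infinite_run_def by auto
    moreover have "\<rho> c \<noteq> x" using rank_one_run[OF c] fg by auto
    ultimately have "(\<rho> c, x) \<notin> r" using order_facts(2) by (meson antisymD)
    then show "c \<in> layer (under r x)" unfolding layer_def under_def by auto
  qed
qed

text \<open>An embedding maps \<beta> onto an initial segment of \<open>r\<close>, so the recursion
  over abstract well-orders can be followed inside \<open>r\<close>. The same \<open>f\<close> also
  embeds every proper initial segment of \<beta>, which feeds the induction.\<close>

lemma iter_derivative_embed: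
  assumes "Well_order \<beta>" "embed \<beta> r f"
  shows "iter_derivative le T \<beta> = nodes (layer (f ` Field \<beta>))"
  using assms
proof (induction \<beta> arbitrary: f rule: wf_induct_rule[OF wf_ordLess])
  case (1 \<beta>)
  have seg: "iter_derivative le T (Restr \<beta> (underS \<beta> x)) = nodes (layer (underS r (f x)))"
    if x: "x \<in> Field \<beta>" for x
  proof -
    let ?\<gamma> = "Restr \<beta> (underS \<beta> x)"
    have ofil: "wo_rel.ofilter \<beta> (underS \<beta> x)"
      using 1(2) by (simp add: wo_rel.underS_ofilter wo_rel_def)
    have F: "Field ?\<gamma> = underS \<beta> x"
      using 1(2) ofil by (simp add: Field_Restr_ofilter)
    have "?\<gamma> <o \<beta>" using 1(2) x by (intro underS_Restr_ordLess) auto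
    moreover have "Well_order ?\<gamma>" using 1(2) by (rule Well_order_Restr)
    moreover have "embed ?\<gamma> r f"
      using comp_embed[of ?\<gamma> \<beta> id r f] 1(2,3) ofil by (simp add: ofilter_embed)
    ultimately have "iter_derivative le T ?\<gamma> = nodes (layer (f ` underS \<beta> x))"
      using 1(1)[of ?\<gamma> f] F by simp
    moreover have "f ` underS \<beta> x = underS r (f x)"
      using embed_underS[OF 1(2,3) x] by (simp add: bij_betw_def)
    ultimately show ?thesis by simp
  qed
  have fF: "f ` Field \<beta> \<subseteq> Field r"
    using 1(3) by (rule embed_Field)
  consider "Field \<beta> = {}" | m where "is_greatest \<beta> m" | "Field \<beta> \<noteq> {}" "\<nexists>m. is_greatest \<beta> m"
    by blast
  then show ?case
  proof cases
    case 1
    then show ?thesis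
      using root_in_T by (subst iter_derivative.simps) (auto simp: nodes_def layer_def)
  next
    case (2 m)
    have "antisym \<beta>" using 1(2) by (simp add: order_on_defs)
    then have "(THE m. is_greatest \<beta> m) = m"
      using 2 by (intro the_equality) (auto simp: is_greatest_def antisym_def)
    moreover have m: "m \<in> Field \<beta>" "under \<beta> m = Field \<beta>"
      using 2 by (auto simp: is_greatest_def under_def Field_def)
    ultimately have "iter_derivative le T \<beta> = derivative le (nodes (layer (underS r (f m))))"
      using 1(2) 2 seg[OF m(1)] by (subst iter_derivative.simps) auto
    also have "\<dots> = nodes (layer (under r (f m)))"
      using fF m(1) by (intro derivative_layer) blast
    also have "under r (f m) = f ` Field \<beta>"
      using 1(3) m unfolding embed_def bij_betw_def by metis
    finally show ?thesis .
  next
    case 3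
    have "iter_derivative le T \<beta> = (\<Inter>x\<in>Field \<beta>. iter_derivative le T (Restr \<beta> (underS \<beta> x)))"
      using 1(2) 3 by (subst iter_derivative.simps) auto
    also have "\<dots> = (\<Inter>x\<in>Field \<beta>. nodes (layer (underS r (f x))))"
      using seg by simp
    also have "\<dots> = nodes (layer (\<Union>x\<in>Field \<beta>. underS r (f x)))"
      using 3(1) unfolding nodes_def layer_def by blast
    also have "(\<Union>x\<in>Field \<beta>. underS r (f x)) = (\<Union>x\<in>Field \<beta>. f ` underS \<beta> x)"
      using embed_underS[OF 1(2,3)] by (simp add: bij_betw_def)
    also have "\<dots> = f ` (\<Union>x\<in>Field \<beta>. underS \<beta> x)" by blast
    \<comment> \<open>Without a greatest element each \<open>y\<close> has some \<open>z\<close>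
      strictly above it, so the proper segments exhaust the limit.\<close>
    also have "(\<Union>x\<in>Field \<beta>. underS \<beta> x) = Field \<beta>"
    proof
      show "(\<Union>x\<in>Field \<beta>. underS \<beta> x) \<subseteq> Field \<beta>"
        by (auto simp: underS_def Field_def)
      show "Field \<beta> \<subseteq> (\<Union>x\<in>Field \<beta>. underS \<beta> x)"
      proof
        fix y assume y: "y \<in> Field \<beta>"
        then obtain z where z: "z \<in> Field \<beta>" "(z, y) \<notin> \<beta>"
          using 3(2) unfolding is_greatest_def by blast
        have "refl_on (Field \<beta>) \<beta>" "total_on (Field \<beta>) \<beta>"
          using 1(2) by (simp_all add: order_on_defs)
        then have "(y, y) \<in> \<beta>" "y = z \<or> (y, z) \<in> \<beta> \<or> (z, y) \<in> \<beta>"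
          using y z by (auto simp: refl_on_def total_on_def)
        then have "y \<in> underS \<beta> z" using z by (auto simp: underS_def)
        then show "y \<in> (\<Union>x\<in>Field \<beta>. underS \<beta> x)" using z by blast
      qed
    qed
    finally show ?thesis .
  qed
qed

theorem has_CB_rank:
  assumes "\<alpha> =o r"
  shows "has_CB_rank T le \<alpha>"
  unfolding has_CB_rank_def
proof (intro conjI allI impI)
  show \<alpha>: "Well_order \<alpha>" using assms unfolding ordIso_def by blast
  obtain f where f: "embed \<alpha> r f" "f ` Field \<alpha> = Field r"
    using assms unfolding ordIso_def iso_def bij_betw_def by blast
  have "layer (Field r) = kern" using rank_Field unfolding layer_def by blast
  then have "iter_derivative le T \<alpha> = nodes kern"
    using iter_derivative_embed[OF \<alpha> f(1)] f(2) by simp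
  then show "iter_derivative le T \<alpha> = derivative le (iter_derivative le T \<alpha>)"
    by (simp add: derivative_kern)
  fix \<beta> :: "'b rel"
  assume "\<beta> <o \<alpha>"
  then have "\<beta> <o r" using assms by (rule ordLess_ordIso_trans)
  then obtain g where \<beta>: "Well_order \<beta>" and g: "embedS \<beta> r g" unfolding ordLess_def by blast
  then have emb: "embed \<beta> r g" unfolding embedS_def by blast
  then have "g ` Field \<beta> \<subset> Field r" using embedS_iff[OF \<beta> emb] g by simp
  moreover have "wo_rel.ofilter r (g ` Field \<beta>)" using \<beta> wo emb by (rule embed_Field_ofilter)
  ultimately obtain x where x: "x \<in> Field r" "g ` Field \<beta> = underS r x"
    using wo_rel.ofilter_underS_Field[of r "g ` Field \<beta>"] wo by (auto simp: wo_rel_def)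
  then have iter: "iter_derivative le T \<beta> = nodes (layer (underS r x))"
    using iter_derivative_embed[OF \<beta> emb] by simp
  \<comment> \<open>A node of rank exactly \<open>x\<close> is lost in the next derivative, so the
    sequence has not stabilised at \<beta>.\<close>
  obtain w where w: "w \<in> T - {\<epsilon>}" "conf w \<notin> kern" "\<rho> (conf w) = x"
    using rank_surj[OF x(1)] by blast
  then have "w \<in> nodes (layer (underS r x))" "w \<notin> nodes (layer (under r x))"
    using order_facts(3)[OF x(1)] unfolding nodes_def layer_def under_def underS_def by auto
  then show "iter_derivative le T \<beta> \<noteq> derivative le (iter_derivative le T \<beta>)"
    unfolding iter derivative_layer[OF x(1)] by blast
qed

end

section \<open>Automatic trees of counter machine histories\<close>

text \<open>
  Registers below \<open>m\<close> are work registers for \<open>p\<close>; register \<open>m\<close> holds the current element \<open>x\<close>,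
  \<open>m + 1\<close> the guessed \<open>y\<close>, and \<open>m + 2\<close> the height on the spine. Operations are relations
  rather than functions (\<open>OGuess\<close> has many outcomes), but each of them determines the registers
  before from the registers after.
\<close>

datatype state = Spine | Clear | Prog nat | Flush | Kernel

datatype op = OInc nat | ODec nat nat | OZero nat | OGuess | OInit | OMove

fun sem :: "nat \<Rightarrow> op \<Rightarrow> (nat \<Rightarrow> nat) \<Rightarrow> (nat \<Rightarrow> nat) \<Rightarrow> bool" where
  "sem m (OInc i) R R' \<longleftrightarrow> R' = R(i := Suc (R i))"
| "sem m (ODec n i) R R' \<longleftrightarrow> (\<forall>j<n. R j = 0) \<and> R = R'(i := Suc (R' i))"
| "sem m (OZero i) R R' \<longleftrightarrow> R i = 0 \<and> R' = R"
| "sem m OGuess R R' \<longleftrightarrow> R (Suc m) = 0 \<and> (\<exists>y \<le> R (Suc (Suc m)). R' = R(Suc m := y))"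
| "sem m OInit R R' \<longleftrightarrow> (\<forall>j<m. R j = 0) \<and> R (Suc m) \<noteq> R m \<and> R' = R(0 := R (Suc m), 1 := R m)"
| "sem m OMove R R' \<longleftrightarrow> R m = 0 \<and> R' = R(m := R (Suc m), Suc m := 0)"

text \<open>Whatever an operation overwrites was either forced to be zero by its guard or is
  recoverable from the new contents. This is the source of unique parents.\<close>

lemma sem_backward_unique:
  assumes "2 \<le> m" "sem m a R1 R'" "sem m a R2 R'"
  shows "R1 = R2"
proof (cases a)
  case (OInc i)
  then show ?thesis using assms(2,3) by (simp add: fun_eq_iff) (metis nat.inject)
next
  case OGuess
  then have "R1 = R'(Suc m := 0)" "R2 = R'(Suc m := 0)"
    using assms(2,3) by (auto simp: fun_eq_iff)
  then show ?thesis by simp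
next
  case OInit
  have "0 < m" "1 < m" using assms by auto
  then have "R = R'(0 := 0, 1 := 0)" if "sem m OInit R R'" for R
    using that by (auto simp: fun_eq_iff)
  then have "R1 = R'(0 := 0, 1 := 0)" "R2 = R'(0 := 0, 1 := 0)"
    using assms(2,3) unfolding OInit by blast+
  then show ?thesis by simp
next
  case OMove
  have "R = R'(m := 0, Suc m := R' m)" if "sem m OMove R R'" for R
    using that by (auto simp: fun_eq_iff)
  then have "R1 = R'(m := 0, Suc m := R' m)" "R2 = R'(m := 0, Suc m := R' m)"
    using assms(2,3) unfolding OMove by blast+
  then show ?thesis by simp
qed (use assms in auto)

text \<open>Copies and guesses are bounded by an existing register, so only an increment can exceed
  the old maximum, by one. The history grows by one entry in the same step.\<close>

lemma sem_growth:
  assumes "sem m a R R'" "\<And>i. R i \<le> n"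
  shows "R' i \<le> Suc n"
proof (cases a)
  case (ODec l j)
  then have "R' i \<le> R i" using assms(1) by (auto simp: fun_eq_iff)
  then show ?thesis using assms(2)[of i] by simp
next
  case OGuess
  then show ?thesis using assms(1) assms(2)[of i] assms(2)[of "Suc (Suc m)"] by auto
qed (use assms in \<open>auto simp: le_SucI\<close>)

definition bits :: "(nat \<Rightarrow> nat) \<Rightarrow> nat \<Rightarrow> nat set" where
  "bits R j = {i. j < R i}"

text \<open>
  Registers are written in unary on parallel tracks: \<open>bits R j\<close> is the set of tracks with a mark in
  column \<open>j\<close>. The effect of an operation is then a condition on the first column, on single columns,
  on adjacent columns, and on the existence of one column, which a finite automaton can check.
\<close>

fun first_ok :: "nat \<Rightarrow> op \<Rightarrow> nat set \<Rightarrow> nat set \<Rightarrow> bool" where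
  "first_ok m (OInc i) s s' \<longleftrightarrow> i \<in> s'"
| "first_ok m (ODec n i) s s' \<longleftrightarrow> i \<in> s \<and> (\<forall>j<n. j \<notin> s)"
| "first_ok m (OZero i) s s' \<longleftrightarrow> i \<notin> s"
| "first_ok m OGuess s s' \<longleftrightarrow> Suc m \<notin> s"
| "first_ok m OInit s s' \<longleftrightarrow> (\<forall>j<m. j \<notin> s)"
| "first_ok m OMove s s' \<longleftrightarrow> m \<notin> s"

fun column_ok :: "nat \<Rightarrow> op \<Rightarrow> nat set \<Rightarrow> nat set \<Rightarrow> bool" where
  "column_ok m (OInc i) s s' \<longleftrightarrow> (\<forall>j. j \<noteq> i \<longrightarrow> (j \<in> s' \<longleftrightarrow> j \<in> s))"
| "column_ok m (ODec n i) s s' \<longleftrightarrow> (\<forall>j. j \<noteq> i \<longrightarrow> (j \<in> s' \<longleftrightarrow> j \<in> s))"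
| "column_ok m (OZero i) s s' \<longleftrightarrow> (\<forall>j. j \<in> s' \<longleftrightarrow> j \<in> s)"
| "column_ok m OGuess s s' \<longleftrightarrow>
     (\<forall>j. j \<noteq> Suc m \<longrightarrow> (j \<in> s' \<longleftrightarrow> j \<in> s)) \<and> (Suc m \<in> s' \<longrightarrow> Suc (Suc m) \<in> s)"
| "column_ok m OInit s s' \<longleftrightarrow>
     (\<forall>j. j \<noteq> 0 \<and> j \<noteq> 1 \<longrightarrow> (j \<in> s' \<longleftrightarrow> j \<in> s)) \<and> (0 \<in> s' \<longleftrightarrow> Suc m \<in> s) \<and> (1 \<in> s' \<longleftrightarrow> m \<in> s)"
| "column_ok m OMove s s' \<longleftrightarrow>
     (\<forall>j. j \<noteq> m \<and> j \<noteq> Suc m \<longrightarrow> (j \<in> s' \<longleftrightarrow> j \<in> s)) \<and> (m \<in> s' \<longleftrightarrow> Suc m \<in> s) \<and> Suc m \<notin> s'"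

fun adjacent_ok :: "op \<Rightarrow> nat set \<Rightarrow> nat set \<Rightarrow> nat set \<Rightarrow> nat set \<Rightarrow> bool" where
  "adjacent_ok (OInc i) s s' t t' \<longleftrightarrow> (i \<in> t' \<longleftrightarrow> i \<in> s)"
| "adjacent_ok (ODec n i) s s' t t' \<longleftrightarrow> (i \<in> t \<longleftrightarrow> i \<in> s')"
| "adjacent_ok _ s s' t t' \<longleftrightarrow> True"

fun witness_ok :: "nat \<Rightarrow> op \<Rightarrow> nat set \<Rightarrow> nat set \<Rightarrow> bool" where
  "witness_ok m OInit s s' \<longleftrightarrow> (m \<in> s) \<noteq> (Suc m \<in> s)"
| "witness_ok m _ s s' \<longleftrightarrow> True"

lemma bits_zero: "R i = 0 \<longleftrightarrow> i \<notin> bits R 0"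
  by (simp add: bits_def)

lemma bits_eq: "R' i = R j \<longleftrightarrow> (\<forall>l. i \<in> bits R' l \<longleftrightarrow> j \<in> bits R l)"
  unfolding bits_def by simp (metis nat_neq_iff)

lemma bits_le: "R' i \<le> R j \<longleftrightarrow> (\<forall>l. i \<in> bits R' l \<longrightarrow> j \<in> bits R l)"
  unfolding bits_def by simp (meson leI less_le_trans order_less_irrefl)

lemma bits_Suc: "R' i = Suc (R j) \<longleftrightarrow> i \<in> bits R' 0 \<and> (\<forall>l. i \<in> bits R' (Suc l) \<longleftrightarrow> j \<in> bits R l)"
  unfolding bits_def by (cases "R' i") (simp_all, metis nat_neq_iff)

lemma upd_eq_iff: "R' = R(i := x) \<longleftrightarrow> R' i = x \<and> (\<forall>j. j \<noteq> i \<longrightarrow> R' j = R j)"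
  by (auto simp: fun_eq_iff)

text \<open>In unary, an equality or a bound between registers is a condition on each column
  separately, a successor compares neighbouring columns, and only the disequality in
  \<open>OInit\<close> asks for a column to exist.\<close>

lemma sem_iff_columns:
  assumes "2 \<le> m"
  shows "sem m a R R' \<longleftrightarrow> first_ok m a (bits R 0) (bits R' 0) \<and> (\<forall>j. column_ok m a (bits R j) (bits R' j)) \<and>
    (\<forall>j. adjacent_ok a (bits R j) (bits R' j) (bits R (Suc j)) (bits R' (Suc j))) \<and>
    (\<exists>j. witness_ok m a (bits R j) (bits R' j))"
proof (cases a)
  case (OInc i)
  have "sem m a R R' \<longleftrightarrow> R' i = Suc (R i) \<and> (\<forall>j. j \<noteq> i \<longrightarrow> R' j = R j)"
    unfolding OInc sem.simps by (rule upd_eq_iff)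
  also have "\<dots> \<longleftrightarrow> (i \<in> bits R' 0 \<and> (\<forall>l. i \<in> bits R' (Suc l) \<longleftrightarrow> i \<in> bits R l)) \<and>
      (\<forall>j. j \<noteq> i \<longrightarrow> (\<forall>l. j \<in> bits R' l \<longleftrightarrow> j \<in> bits R l))"
    by (simp only: bits_Suc bits_eq[of R' _ R])
  finally show ?thesis unfolding OInc by simp blast
next
  case (ODec n i)
  have "sem m a R R' \<longleftrightarrow> (\<forall>j<n. R j = 0) \<and> R i = Suc (R' i) \<and> (\<forall>j. j \<noteq> i \<longrightarrow> R' j = R j)"
    unfolding ODec sem.simps upd_eq_iff by auto
  also have "\<dots> \<longleftrightarrow> (\<forall>j<n. j \<notin> bits R 0) \<and>
      (i \<in> bits R 0 \<and> (\<forall>l. i \<in> bits R (Suc l) \<longleftrightarrow> i \<in> bits R' l)) \<and>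
      (\<forall>j. j \<noteq> i \<longrightarrow> (\<forall>l. j \<in> bits R' l \<longleftrightarrow> j \<in> bits R l))"
    by (simp only: bits_Suc bits_zero bits_eq[of R' _ R])
  finally show ?thesis unfolding ODec by simp blast
next
  case (OZero i)
  have "sem m a R R' \<longleftrightarrow> R i = 0 \<and> (\<forall>j. R' j = R j)"
    unfolding OZero by auto
  also have "\<dots> \<longleftrightarrow> i \<notin> bits R 0 \<and> (\<forall>j l. j \<in> bits R' l \<longleftrightarrow> j \<in> bits R l)"
    by (simp only: bits_zero bits_eq[of R' _ R])
  finally show ?thesis unfolding OZero by simp blast
next
  case OGuess
  have "sem m a R R' \<longleftrightarrow> R (Suc m) = 0 \<and> R' (Suc m) \<le> R (Suc (Suc m)) \<and> (\<forall>j. j \<noteq> Suc m \<longrightarrow> R' j = R j)"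
    unfolding OGuess sem.simps upd_eq_iff by auto
  also have "\<dots> \<longleftrightarrow> Suc m \<notin> bits R 0 \<and> (\<forall>l. Suc m \<in> bits R' l \<longrightarrow> Suc (Suc m) \<in> bits R l) \<and>
      (\<forall>j. j \<noteq> Suc m \<longrightarrow> (\<forall>l. j \<in> bits R' l \<longleftrightarrow> j \<in> bits R l))"
    by (simp only: bits_zero bits_le bits_eq[of R' _ R])
  finally show ?thesis unfolding OGuess by simp blast
next
  case OInit
  have "sem m a R R' \<longleftrightarrow> (\<forall>j<m. R j = 0) \<and> R (Suc m) \<noteq> R m \<and>
      R' 0 = R (Suc m) \<and> R' 1 = R m \<and> (\<forall>j. j \<noteq> 0 \<and> j \<noteq> 1 \<longrightarrow> R' j = R j)"
    unfolding OInit by (auto simp: fun_eq_iff)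
  also have "\<dots> \<longleftrightarrow> (\<forall>j<m. j \<notin> bits R 0) \<and> \<not> (\<forall>l. Suc m \<in> bits R l \<longleftrightarrow> m \<in> bits R l) \<and>
      (\<forall>l. 0 \<in> bits R' l \<longleftrightarrow> Suc m \<in> bits R l) \<and> (\<forall>l. 1 \<in> bits R' l \<longleftrightarrow> m \<in> bits R l) \<and>
      (\<forall>j. j \<noteq> 0 \<and> j \<noteq> 1 \<longrightarrow> (\<forall>l. j \<in> bits R' l \<longleftrightarrow> j \<in> bits R l))"
    by (simp only: bits_zero bits_eq[of R' _ R] bits_eq[of R _ R])
  also have "\<dots> \<longleftrightarrow> (\<forall>j<m. j \<notin> bits R 0) \<and> (\<forall>l. column_ok m OInit (bits R l) (bits R' l)) \<and>
      (\<exists>l. witness_ok m OInit (bits R l) (bits R' l))"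
  proof -
    have "(\<forall>l. column_ok m OInit (bits R l) (bits R' l)) \<longleftrightarrow>
      (\<forall>l. 0 \<in> bits R' l \<longleftrightarrow> Suc m \<in> bits R l) \<and> (\<forall>l. 1 \<in> bits R' l \<longleftrightarrow> m \<in> bits R l) \<and>
      (\<forall>j. j \<noteq> 0 \<and> j \<noteq> 1 \<longrightarrow> (\<forall>l. j \<in> bits R' l \<longleftrightarrow> j \<in> bits R l))"
      unfolding column_ok.simps all_conj_distrib by meson
    moreover have "(\<exists>l. witness_ok m OInit (bits R l) (bits R' l)) \<longleftrightarrow>
        \<not> (\<forall>l. Suc m \<in> bits R l \<longleftrightarrow> m \<in> bits R l)"
      by auto
    ultimately show ?thesis by argo
  qed
  finally show ?thesis unfolding OInit by simp
next
  case OMove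
  \<comment> \<open>Writing the last equality with zero as \<open>\<le> 0\<close> brings it under
    \<open>bits_le\<close>, which empties the track in every column as \<open>column_ok\<close>
    demands, not only in the first.\<close>
  have "sem m a R R' \<longleftrightarrow> R m = 0 \<and> R' m = R (Suc m) \<and> R' (Suc m) \<le> 0 \<and>
      (\<forall>j. j \<noteq> m \<and> j \<noteq> Suc m \<longrightarrow> R' j = R j)"
    unfolding OMove sem.simps upd_eq_iff[of R' _ "Suc m"] by (auto simp: fun_upd_apply)
  also have "\<dots> \<longleftrightarrow> m \<notin> bits R 0 \<and> (\<forall>l. m \<in> bits R' l \<longleftrightarrow> Suc m \<in> bits R l) \<and>
      (\<forall>l. Suc m \<notin> bits R' l) \<and>
      (\<forall>j. j \<noteq> m \<and> j \<noteq> Suc m \<longrightarrow> (\<forall>l. j \<in> bits R' l \<longleftrightarrow> j \<in> bits R l))"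
    using bits_le[of R' "Suc m" "\<lambda>_. 0"] by (simp only: bits_zero bits_eq[of R' _ R]) (simp add: bits_def)
  finally show ?thesis unfolding OMove by simp blast
qed

text \<open>Columns beyond both words are empty and impose nothing. A witness among them shows that
  the operation is not \<open>OInit\<close>, so any column will do.\<close>

lemma columns_ok_empty:
  "column_ok m a {} {}" "adjacent_ok a {} {} {} {}"
  "witness_ok m a {} {} \<Longrightarrow> witness_ok m a s s'"
  by (cases a; simp)+

lemma bits_inject: "(\<And>j. bits R j = bits R' j) \<Longrightarrow> R = R'"
  by (rule ext) (simp add: bits_eq)

type_synonym trans = "state \<times> op \<times> state"

definition config_step :: "nat \<Rightarrow> trans set \<Rightarrow> (state \<times> (nat \<Rightarrow> nat)) rel" where
  "config_step m D = {((q, R), (q', R')) | q R q' R'. \<exists>a. (q, a, q') \<in> D \<and> sem m a R R'}"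

text \<open>\<open>k\<close> bounds the registers in use, so letters (a transition with a set of
  tracks) are finite in number; \<open>code\<close> turns them into numbers, as
  \<open>automatic\<close> requires. \<open>D_unambiguous\<close> prevents two siblings from
  carrying the same configuration.\<close>

locale counter_tree =
  fixes m k :: nat and D :: "trans set" and code :: "trans \<times> nat set \<Rightarrow> nat"
  assumes finite_D: "finite D" and inj_code: "inj_on code (D \<times> Pow {..<k})"
    and m_ge_2: "2 \<le> m"
    and D_registers: "(q, a, q') \<in> D \<Longrightarrow> sem m a R R' \<Longrightarrow> k \<le> i \<Longrightarrow> R' i = R i"
    and D_unambiguous: "(q, a, q') \<in> D \<Longrightarrow> (q, b, q') \<in> D \<Longrightarrow> sem m a R R' \<Longrightarrow> sem m b R R' \<Longrightarrow> a = b"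
begin

text \<open>Neither consecutive transitions nor \<open>R\<close> have to be consistent with the
  history; this keeps the set of nodes recognisable.\<close>

definition node :: "trans list \<Rightarrow> (nat \<Rightarrow> nat) \<Rightarrow> bool" where
  "node h R \<longleftrightarrow> set h \<subseteq> D \<and> (\<forall>i. R i \<le> length h) \<and> (\<forall>i\<ge>k. R i = 0)"

text \<open>
  Since \<open>R i \<le> length h\<close>, the tracks fit below the history. The history grows at its end, so the word
  of a child agrees with that of its parent up to the columns where a unary register changes.
\<close>

definition enc :: "trans list \<Rightarrow> (nat \<Rightarrow> nat) \<Rightarrow> nat list" where
  "enc h R = map (\<lambda>j. code (h ! j, bits R j)) [0..<length h]"

definition alphabet :: "nat set" where
  "alphabet = code ` (D \<times> Pow {..<k})"

definition letter :: "nat \<Rightarrow> trans \<times> nat set" where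
  "letter = inv_into (D \<times> Pow {..<k}) code"

definition T :: "nat list set" where
  "T = {enc h R | h R. node h R}"

text \<open>Fixing the transition fixes the operation and thereby the local conditions to be
  checked; \<open>E\<close> is a finite union of such relations. The condition
  \<open>h \<noteq> []\<close> keeps the root out of \<open>E\<close>.\<close>

definition E_by :: "trans \<Rightarrow> nat list rel" where
  "E_by d = {(enc h R, enc (h @ [d]) R') | h R R'. node h R \<and> node (h @ [d]) R' \<and> h \<noteq> [] \<and>
     snd (snd (last h)) = fst d \<and> sem m (fst (snd d)) R R'}"

definition E :: "nat list rel" where
  "E = (\<Union>d\<in>D. E_by d)"

definition conf :: "nat list \<Rightarrow> state \<times> (nat \<Rightarrow> nat)" where
  "conf w = (SOME c. \<exists>h R. node h R \<and> w = enc h R \<and> c = (snd (snd (last h)), R))"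

abbreviation stp :: "(state \<times> (nat \<Rightarrow> nat)) rel" where
  "stp \<equiv> config_step m D"

lemma finite_alphabet: "finite alphabet"
  unfolding alphabet_def using finite_D by simp

lemma letter_alphabet: "c \<in> alphabet \<Longrightarrow> letter c \<in> D \<times> Pow {..<k} \<and> code (letter c) = c"
  unfolding alphabet_def letter_def by (metis f_inv_into_f inv_into_into)

lemma letter_code: "d \<in> D \<Longrightarrow> s \<subseteq> {..<k} \<Longrightarrow> letter (code (d, s)) = (d, s)"
  unfolding letter_def using inj_code by (intro inv_into_f_f) auto

lemma bits_subset: "node h R \<Longrightarrow> bits R j \<subseteq> {..<k}"
  unfolding node_def bits_def by (metis (mono_tags) lessThan_iff linorder_not_less mem_Collect_eq not_less_zero subsetI)

lemma bits_beyond: "node h R \<Longrightarrow> length h \<le> j \<Longrightarrow> bits R j = {}"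
  unfolding node_def bits_def by (auto simp: not_less intro: order_trans)

lemma bits_mono: "bits R (Suc j) \<subseteq> bits R j"
  unfolding bits_def by auto

lemma length_enc [simp]: "length (enc h R) = length h"
  by (simp add: enc_def)

lemma enc_nth: "j < length h \<Longrightarrow> enc h R ! j = code (h ! j, bits R j)"
  by (simp add: enc_def)

lemma enc_in_alphabet: "node h R \<Longrightarrow> j < length h \<Longrightarrow> enc h R ! j \<in> alphabet"
  unfolding alphabet_def enc_nth by (intro imageI) (use bits_subset in \<open>auto simp: node_def\<close>)

lemma enc_lists: "node h R \<Longrightarrow> enc h R \<in> lists alphabet"
  by (metis enc_in_alphabet in_listsI in_set_conv_nth length_enc)

lemma letter_enc: "node h R \<Longrightarrow> j < length h \<Longrightarrow> letter (enc h R ! j) = (h ! j, bits R j)"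
  unfolding enc_nth by (rule letter_code) (use bits_subset in \<open>auto simp: node_def\<close>)

lemma enc_inject:
  assumes "node h R" "node h' R'" "enc h R = enc h' R'"
  shows "h = h' \<and> R = R'"
proof -
  have len: "length h = length h'" using assms(3) length_enc by metis
  have eq: "(h ! j, bits R j) = (h' ! j, bits R' j)" if "j < length h" for j
    using letter_enc[OF assms(1) that] letter_enc[OF assms(2), of j] that len assms(3) by simp
  have "bits R j = bits R' j" for j
  proof (cases "j < length h")
    case False
    then show ?thesis using bits_beyond[OF assms(1), of j] bits_beyond[OF assms(2), of j] len by simp
  qed (use eq in simp)
  then have "R = R'" by (rule bits_inject)
  moreover have "h = h'" using len eq by (auto intro: nth_equalityI)
  ultimately show ?thesis by simp
qed

lemma conf_enc: "node h R \<Longrightarrow> conf (enc h R) = (snd (snd (last h)), R)"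
  unfolding conf_def by (rule some_equality) (auto dest: enc_inject)

text \<open>Shrinking track sets are precisely unary notations: a register is the index of the first
  column without its mark, which exists because all tracks end with the word.\<close>

lemma word_is_enc:
  assumes v: "v \<in> lists alphabet" and mono: "successively (\<lambda>a b. snd (letter b) \<subseteq> snd (letter a)) v"
  shows "\<exists>h R. node h R \<and> v = enc h R"
proof -
  define s where "s j = (if j < length v then snd (letter (v ! j)) else {})" for j
  define R where "R i = (LEAST j. i \<notin> s j)" for i
  define h where "h = map (fst \<circ> letter) v"
  have vA: "v ! j \<in> alphabet" if "j < length v" for j using v that by auto
  have "s (Suc j) \<subseteq> s j" for j
    using mono unfolding s_def successively_conv_nth by auto
  then have anti: "s j' \<subseteq> s j" if "j \<le> j'" for j j'
    using that by (rule lift_Suc_antimono_le)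
  have s_end: "i \<notin> s (length v)" for i unfolding s_def by simp
  have less_R: "j < R i \<longleftrightarrow> i \<in> s j" for i j
  proof
    show "j < R i \<Longrightarrow> i \<in> s j" unfolding R_def using not_less_Least by blast
    have "i \<notin> s (R i)" unfolding R_def using s_end by (rule LeastI)
    then show "i \<in> s j \<Longrightarrow> j < R i" using anti[of "R i" j] by (meson leI subsetD)
  qed
  have bits: "bits R j = s j" for j unfolding bits_def less_R by simp
  have "node h R"
    unfolding node_def
  proof (intro conjI allI impI)
    show "set h \<subseteq> D" unfolding h_def using v letter_alphabet by force
    show "R i \<le> length h" for i unfolding R_def h_def using Least_le[of "\<lambda>j. i \<notin> s j", OF s_end] by simp
    show "R i = 0" if "k \<le> i" for i
    proof -
      have "snd (letter (v ! 0)) \<subseteq> {..<k}" if "0 < length v"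
        using letter_alphabet[OF vA[OF that]] by (auto simp: mem_Times_iff)
      then have "s 0 \<subseteq> {..<k}" unfolding s_def by simp
      then have "i \<notin> s 0" using that by auto
      then show ?thesis using less_R[of 0 i] by simp
    qed
  qed
  moreover have "v = enc h R"
  proof (rule nth_equalityI)
    fix j assume j: "j < length v"
    then have "enc h R ! j = code (letter (v ! j))"
      by (simp add: enc_nth h_def bits) (simp add: s_def)
    then show "v ! j = enc h R ! j" using letter_alphabet[OF vA[OF j]] by simp
  qed (simp add: h_def)
  ultimately show ?thesis by blast
qed

lemma enc_mono:
  assumes "node h R"
  shows "successively (\<lambda>a b. snd (letter b) \<subseteq> snd (letter a)) (enc h R)"
  unfolding successively_conv_nth using letter_enc[OF assms] bits_mono by simp

lemma T_eq: "T = {v \<in> lists alphabet. successively (\<lambda>a b. snd (letter b) \<subseteq> snd (letter a)) v}"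
  unfolding T_def using enc_lists enc_mono word_is_enc by blast

lemma regular_T: "regular alphabet T"
proof -
  have "T = {[]} \<union> local_language alphabet (\<lambda>_. True) (\<lambda>a b. snd (letter b) \<subseteq> snd (letter a)) (\<lambda>_. True) (\<lambda>_. True)"
    unfolding T_eq local_language_def by (auto simp: ex_in_conv)
  then show ?thesis
    using regular_Un[OF regular_Nil regular_local_language[OF finite_alphabet order_refl]] by metis
qed

section \<open>Regularity of the edge relation\<close>

definition pad_bits :: "nat option \<Rightarrow> nat set" where
  "pad_bits c = (case c of None \<Rightarrow> {} | Some a \<Rightarrow> snd (letter a))"

lemma pad_bits_simps [simp]: "pad_bits None = {}" "pad_bits (Some a) = snd (letter a)"
  by (simp_all add: pad_bits_def)

lemma pad_bits_enc: "node h R \<Longrightarrow> pad_bits (pad_nth (enc h R) j) = bits R j"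
  by (cases "j < length h") (simp_all add: pad_nth_def letter_enc bits_beyond)

text \<open>A child has one column more than its parent, so the convolution is padded only on the
  left and only in its last column. The four clauses of \<open>sem_iff_columns\<close> go into
  \<open>F\<close>, \<open>B\<close>, \<open>Q\<close> with \<open>G\<close>, and
  \<open>W\<close>.\<close>

lemma regular_E_by:
  assumes d: "d \<in> D"
  shows "regular (padded alphabet \<times> padded alphabet) {convolution u v | u v. (u, v) \<in> E_by d}"
proof -
  let ?a = "fst (snd d)"
  let ?lab = "\<lambda>c. fst (letter (the c))"
  define B where "B = {(x, y). x \<in> padded alphabet \<and> y \<in> Some ` alphabet \<and>
    (x \<noteq> None \<longrightarrow> ?lab x = ?lab y) \<and> column_ok m ?a (pad_bits x) (pad_bits y)}"
  define F where "F c \<longleftrightarrow> fst c \<noteq> None \<and> first_ok m ?a (pad_bits (fst c)) (pad_bits (snd c))"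
    for c :: "nat option \<times> nat option"
  \<comment> \<open>A column that has a successor must be unpadded; together with \<open>G\<close>
    this makes the second word longer by exactly one.\<close>
  define Q where "Q c e \<longleftrightarrow> fst c \<noteq> None \<and> pad_bits (fst e) \<subseteq> pad_bits (fst c) \<and>
    pad_bits (snd e) \<subseteq> pad_bits (snd c) \<and>
    adjacent_ok ?a (pad_bits (fst c)) (pad_bits (snd c)) (pad_bits (fst e)) (pad_bits (snd e)) \<and>
    (fst e = None \<longrightarrow> ?lab (snd e) = d \<and> snd (snd (?lab (fst c))) = fst d)"
    for c e :: "nat option \<times> nat option"
  \<comment> \<open>The empty sets stand for the padded left side and for the first column after
    both words, which an adjacency condition still inspects.\<close>
  define G where "G c \<longleftrightarrow> fst c = None \<and> adjacent_ok ?a {} (pad_bits (snd c)) {} {}"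
    for c :: "nat option \<times> nat option"
  define W where "W c \<longleftrightarrow> witness_ok m ?a (pad_bits (fst c)) (pad_bits (snd c))"
    for c :: "nat option \<times> nat option"
  have "{convolution u v | u v. (u, v) \<in> E_by d} = local_language B F Q G W"
  proof (intro set_eqI iffI)
    fix w assume "w \<in> {convolution u v | u v. (u, v) \<in> E_by d}"
    then obtain h R R' where w: "w = convolution (enc h R) (enc (h @ [d]) R')"
      and n: "node h R" and n': "node (h @ [d]) R'" and h: "h \<noteq> []" and last: "snd (snd (last h)) = fst d"
      and sem: "sem m ?a R R'"
      unfolding E_by_def by auto
    let ?n = "length h"
    let ?u = "enc h R" and ?v = "enc (h @ [d]) R'"
    have len: "length w = Suc ?n" unfolding w by simp
    have nth: "w ! j = (pad_nth ?u j, pad_nth ?v j)" if "j \<le> ?n" for j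
      unfolding w using that by (intro nth_convolution) auto
    have bu: "pad_bits (pad_nth ?u j) = bits R j" and bv: "pad_bits (pad_nth ?v j) = bits R' j" for j
      using pad_bits_enc[OF n] pad_bits_enc[OF n'] by auto
    have pu: "pad_nth ?u j = (if j < ?n then Some (?u ! j) else None)" for j by (simp add: pad_nth_def)
    have pv: "pad_nth ?v j = Some (?v ! j)" if "j \<le> ?n" for j using that by (simp add: pad_nth_def)
    note cols = sem[unfolded sem_iff_columns[OF m_ge_2]]
    have lu: "letter (?u ! j) = (h ! j, bits R j)" if "j < ?n" for j using letter_enc[OF n that] .
    have lv: "letter (?v ! j) = ((h @ [d]) ! j, bits R' j)" if "j \<le> ?n" for j
      using letter_enc[OF n', of j] that by simp
    have "w \<in> lists B"
    proof (rule in_listsI, rule ballI)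
      fix c assume "c \<in> set w"
      then obtain j where j: "j \<le> ?n" "c = w ! j" using len by (auto simp: in_set_conv_nth less_Suc_eq_le)
      have "pad_nth ?u j \<in> padded alphabet"
        using enc_in_alphabet[OF n, of j] by (simp add: pu padded_def)
      moreover have "pad_nth ?v j \<in> Some ` alphabet"
        using enc_in_alphabet[OF n', of j] j by (simp add: pv)
      moreover have "pad_nth ?u j \<noteq> None \<longrightarrow> ?lab (pad_nth ?u j) = ?lab (pad_nth ?v j)"
        using lu[of j] lv[of j] j by (auto simp: pu pv nth_append)
      ultimately show "c \<in> B"
        unfolding j(2) nth[OF j(1)] B_def using cols by (simp add: bu bv)
    qed
    moreover have "w \<noteq> []" using len by auto
    moreover have "F (hd w)"
      using h cols nth[of 0] \<open>w \<noteq> []\<close> by (simp add: hd_conv_nth F_def bu bv) (simp add: pu)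
    moreover have "successively Q w"
      unfolding successively_conv_nth
    proof (intro allI impI)
      fix j assume "Suc j < length w"
      then have j: "j < ?n" using len by simp
      have "pad_nth ?u (Suc j) = None \<longrightarrow> ?lab (pad_nth ?v (Suc j)) = d \<and> snd (snd (?lab (pad_nth ?u j))) = fst d"
        using j h lu[of j] lv[of "Suc j"] last by (auto simp: pu pv last_conv_nth Suc_lessI) 
          (metis One_nat_def Suc_lessI diff_Suc_1 last_conv_nth nth_append_length)+
      then show "Q (w ! j) (w ! Suc j)"
        using cols j bits_mono by (simp add: nth Q_def bu bv) (simp add: pu)
    qed
    moreover have "G (last w)"
    proof -
      have "bits R ?n = {}" "bits R (Suc ?n) = {}" "bits R' (Suc ?n) = {}"
        using bits_beyond[OF n] bits_beyond[OF n'] by auto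
      then have "adjacent_ok ?a {} (bits R' ?n) {} {}" using cols by metis
      then show ?thesis using \<open>w \<noteq> []\<close> len nth[of ?n] by (simp add: last_conv_nth G_def bv) (simp add: pu)
    qed
    moreover have "\<exists>c\<in>set w. W c"
    proof -
      obtain j where j: "witness_ok m ?a (bits R j) (bits R' j)" using cols by blast
      have "\<exists>j\<le>?n. witness_ok m ?a (bits R j) (bits R' j)"
      proof (cases "j \<le> ?n")
        case False
        then have "bits R j = {}" "bits R' j = {}"
          using bits_beyond[OF n, of j] bits_beyond[OF n', of j] by auto
        then show ?thesis using j columns_ok_empty(3) by (metis le0)
      qed (use j in blast)
      then obtain j where "j \<le> ?n" "W (w ! j)" unfolding W_def by (auto simp: nth bu bv)
      then show ?thesis using len by (metis less_Suc_eq_le nth_mem)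
    qed
    ultimately show "w \<in> local_language B F Q G W" unfolding local_language_def by simp
  next
    fix w assume "w \<in> local_language B F Q G W"
    then have wB: "w \<in> lists B" and ne: "w \<noteq> []" and wF: "F (w ! 0)"
      and wQ: "\<And>j. Suc j < length w \<Longrightarrow> Q (w ! j) (w ! Suc j)"
      and wG: "G (last w)" and wW: "\<exists>c\<in>set w. W c"
      unfolding local_language_def by (auto simp: successively_conv_nth hd_conv_nth)
    define n where "n = length w - 1"
    have len: "length w = Suc n" using ne unfolding n_def by (cases w) auto
    have wG': "G (w ! n)" using wG ne len by (simp add: last_conv_nth)
    have "n \<noteq> 0" using wF wG' unfolding F_def G_def by metis
    have wB': "w ! j \<in> B" if "j \<le> n" for j using wB len that by auto
    define u where "u = map (the \<circ> fst) (butlast w)"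
    define v where "v = map (the \<circ> snd) w"
    have lu: "length u = n" and lv: "length v = Suc n" unfolding u_def v_def using len by auto
    have un: "fst (w ! j) = Some (u ! j)" if "j < n" for j
      using wQ[of j] that len by (auto simp: u_def Q_def nth_butlast)
    have wn: "fst (w ! n) = None" using wG' unfolding G_def by simp
    have vn: "snd (w ! j) = Some (v ! j)" if "j \<le> n" for j
      using wB'[OF that] that len by (auto simp: v_def B_def)
    have pu: "pad_nth u j = fst (w ! j)" if "j \<le> n" for j
      using un[of j] wn that lu by (cases "j = n") (auto simp: pad_nth_def)
    have pv: "pad_nth v j = snd (w ! j)" if "j \<le> n" for j
      using vn[OF that] that lv by (simp add: pad_nth_def)
    have w: "w = convolution u v"
      by (rule nth_equalityI) (auto simp: len lu lv nth_convolution less_Suc_eq_le pu pv)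
    have "\<exists>h R. node h R \<and> u = enc h R"
    proof (rule word_is_enc)
      have "u ! j \<in> alphabet" if "j < n" for j
        using wB'[of j] un[OF that] that by (auto simp: B_def padded_def)
      then show "u \<in> lists alphabet" using lu by (auto simp: in_set_conv_nth)
      show "successively (\<lambda>a b. snd (letter b) \<subseteq> snd (letter a)) u"
        unfolding successively_conv_nth lu
      proof (intro allI impI)
        fix j assume "Suc j < n"
        then show "snd (letter (u ! Suc j)) \<subseteq> snd (letter (u ! j))"
          using wQ[of j] len un[of j] un[of "Suc j"] by (simp add: Q_def)
      qed
    qed
    then obtain h R where n: "node h R" and u: "u = enc h R" by blast
    have "\<exists>h R. node h R \<and> v = enc h R"
    proof (rule word_is_enc)
      have "v ! j \<in> alphabet" if "j \<le> n" for j
        using wB'[of j] vn[OF that] that by (auto simp: B_def padded_def)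
      then show "v \<in> lists alphabet" using lv by (auto simp: in_set_conv_nth less_Suc_eq_le)
      show "successively (\<lambda>a b. snd (letter b) \<subseteq> snd (letter a)) v"
        unfolding successively_conv_nth lv
      proof (intro allI impI)
        fix j assume "Suc j < Suc n"
        then show "snd (letter (v ! Suc j)) \<subseteq> snd (letter (v ! j))"
          using wQ[of j] len vn[of j] vn[of "Suc j"] by (simp add: Q_def)
      qed
    qed
    then obtain h' R' where n': "node h' R'" and v: "v = enc h' R'" by blast
    have lh: "length h = n" "length h' = Suc n" using lu lv u v by auto
    have labu: "?lab (fst (w ! j)) = h ! j" if "j < n" for j
      using un[OF that] letter_enc[OF n] that lh u by simp
    have labv: "?lab (snd (w ! j)) = h' ! j" if "j \<le> n" for j
      using vn[OF that] letter_enc[OF n'] that lh v by simp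
    have bu: "pad_bits (fst (w ! j)) = bits R j" and bv: "pad_bits (snd (w ! j)) = bits R' j" if "j \<le> n" for j
      using pad_bits_enc[OF n, of j] pad_bits_enc[OF n', of j] pu[OF that] pv[OF that] u v by auto
    obtain l where l: "n = Suc l" using \<open>n \<noteq> 0\<close> by (cases n) auto
    have Ql: "Q (w ! l) (w ! n)" using wQ[of l] l len by simp
    have "h' = h @ [d]"
    proof (rule nth_equalityI)
      fix j assume "j < length h'"
      then consider "j < n" | "j = n" using lh by linarith
      then show "h' ! j = (h @ [d]) ! j"
      proof cases
        case 1
        then have "?lab (fst (w ! j)) = ?lab (snd (w ! j))"
          using wB'[of j] un[of j] by (auto simp: B_def)
        then show ?thesis using labu[of j] labv[of j] 1 lh by (simp add: nth_append)
      next
        case 2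
        then show ?thesis using Ql wn labv[of n] lh by (simp add: Q_def nth_append)
      qed
    qed (use lh in simp)
    moreover have "h \<noteq> []" using lh \<open>n \<noteq> 0\<close> by auto
    moreover have "snd (snd (last h)) = fst d"
      using Ql wn labu[of l] lh l \<open>h \<noteq> []\<close> by (simp add: Q_def last_conv_nth)
    moreover have "sem m ?a R R'"
      unfolding sem_iff_columns[OF m_ge_2]
    proof (intro conjI allI)
      have out: "bits R j = {}" "bits R' (Suc j) = {}" if "n \<le> j" for j
        using bits_beyond[OF n, of j] bits_beyond[OF n', of "Suc j"] that lh by auto
      show "first_ok m ?a (bits R 0) (bits R' 0)"
        using wF bu[of 0] bv[of 0] by (simp add: F_def)
      show "column_ok m ?a (bits R j) (bits R' j)" for j
      proof (cases "j \<le> n")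
        case True
        then show ?thesis using wB'[OF True] bu[OF True] bv[OF True] by (auto simp: B_def)
      next
        case False
        then obtain i where "j = Suc i" "n \<le> i" by (cases j) auto
        then show ?thesis using out[of i] out[of j] by (simp add: columns_ok_empty)
      qed
      show "adjacent_ok ?a (bits R j) (bits R' j) (bits R (Suc j)) (bits R' (Suc j))" for j
      proof -
        \<comment> \<open>Adjacency comes from \<open>Q\<close> inside the word, from
          \<open>G\<close> at its last column, and holds trivially among the empty columns
          beyond.\<close>
        consider "j < n" | "j = n" | i where "j = Suc i" "n \<le> i"
          by (metis Suc_le_D Suc_le_mono linorder_neqE_nat less_eq_Suc_le)
        then show ?thesis
        proof cases
          case 1
          then show ?thesis using wQ[of j] len bu bv by (simp add: Q_def)
        next
          case 2
          then show ?thesis using wG' out[of n] out[of "Suc n"] bv[of n] by (simp add: G_def)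
        next
          case 3
          then show ?thesis using out[of i] out[of j] out[of "Suc j"] by (simp add: columns_ok_empty)
        qed
      qed
      obtain c where c: "c \<in> set w" "W c" using wW by blast
      then obtain j where "j \<le> n" "W (w ! j)" using len by (auto simp: in_set_conv_nth less_Suc_eq_le)
      then show "\<exists>j. witness_ok m ?a (bits R j) (bits R' j)" using bu bv by (auto simp: W_def)
    qed
    ultimately have "(u, v) \<in> E_by d" unfolding E_by_def using n n' u v by auto
    then show "w \<in> {convolution u v | u v. (u, v) \<in> E_by d}" using w by blast
  qed
  moreover have "B \<subseteq> padded alphabet \<times> padded alphabet" unfolding B_def padded_def by auto
  ultimately show ?thesis
    using regular_local_language[of "padded alphabet \<times> padded alphabet" B] finite_alphabet
    by (simp add: padded_def)
qed

lemma node_Nil: "node [] (\<lambda>_. 0)" unfolding node_def by simp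

lemma nonempty_node: "w \<in> T - {[]} \<longleftrightarrow> (\<exists>h R. node h R \<and> h \<noteq> [] \<and> w = enc h R)"
proof -
  have "enc h R = [] \<longleftrightarrow> h = []" for h R by (simp add: enc_def)
  then show ?thesis unfolding T_def by (auto simp del: length_enc) metis
qed

lemma EE:
  assumes "(u, v) \<in> E"
  obtains h R d R' where "u = enc h R" "v = enc (h @ [d]) R'" "d \<in> D" "node h R" "node (h @ [d]) R'"
    "h \<noteq> []" "snd (snd (last h)) = fst d" "sem m (fst (snd d)) R R'"
  using assms unfolding E_def E_by_def by blast

sublocale rooted_forest T "[]" E length
proof
  show "[] \<in> T" unfolding T_def using node_Nil by (auto simp: enc_def intro!: exI[of _ "[]"])
  show "E \<subseteq> (T - {[]}) \<times> (T - {[]})"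
  proof (rule subrelI)
    fix u v assume "(u, v) \<in> E"
    then show "(u, v) \<in> (T - {[]}) \<times> (T - {[]})" by (rule EE) (use nonempty_node in blast)
  qed
  show "length v = Suc (length u)" if "(u, v) \<in> E" for u v
    using that by (rule EE) simp
  show "u = v" if "(u, w) \<in> E" "(v, w) \<in> E" for u v w
    using that(1)
  proof (rule EE)
    fix h1 R1 d1 R1'
    assume 1: "u = enc h1 R1" "w = enc (h1 @ [d1]) R1'" "node h1 R1" "node (h1 @ [d1]) R1'"
      "sem m (fst (snd d1)) R1 R1'"
    show ?thesis using that(2)
    proof (rule EE)
      fix h2 R2 d2 R2'
      assume 2: "v = enc h2 R2" "w = enc (h2 @ [d2]) R2'" "node h2 R2" "node (h2 @ [d2]) R2'"
        "sem m (fst (snd d2)) R2 R2'"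
      have "h1 @ [d1] = h2 @ [d2] \<and> R1' = R2'" using 1 2 by (intro enc_inject) auto
      then show "u = v" using 1 2 sem_backward_unique[OF m_ge_2] by auto
    qed
  qed
qed

text \<open>The second word of an edge is the longer one, so projecting the convolution yields
  \<open>Range E\<close> without padding; the children of the root are then regular by
  complementation. As the root is the empty word, its edges are these children padded on the
  left.\<close>

lemma automatic_T: "automatic T S"
proof -
  let ?conv = "\<lambda>R. {convolution u v | u v. (u, v) \<in> R}"
  let ?AA = "padded alphabet \<times> padded alphabet"
  have TA: "T \<subseteq> lists alphabet" unfolding T_eq by (rule Collect_restrict)
  have ST: "S \<subseteq> T \<times> T" unfolding S_def using E_nodes root_in_T by blast
  have "?conv E = (\<Union>d\<in>D. ?conv (E_by d))" unfolding E_def by blast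
  then have reg_E: "regular ?AA (?conv E)"
    using regular_UN[OF finite_D regular_E_by] by simp
  have "map (the \<circ> snd) ` ?conv E = Range E"
  proof -
    have "map (the \<circ> snd) (convolution u v) = v" if "(u, v) \<in> E" for u v
      using E_depth[OF that] by (intro map_snd_convolution) simp
    then show ?thesis by force
  qed
  moreover have "Range E \<subseteq> lists alphabet"
    by (rule order_trans[OF _ TA]) (use E_nodes in blast)
  ultimately have "regular alphabet (Range E)"
    using regular_map[OF reg_E, of "the \<circ> snd" alphabet] by simp
  then have reg_roots: "regular alphabet (T - {[]} - Range E)"
    by (intro regular_Diff regular_T regular_Nil)
  have "map (\<lambda>a. (None, Some a)) ` (T - {[]} - Range E) \<subseteq> lists ?AA"
  proof (rule image_subsetI)
    fix v assume "v \<in> T - {[]} - Range E"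
    then have "set v \<subseteq> alphabet" using TA by (auto simp: lists_eq_set)
    then show "map (\<lambda>a. (None, Some a)) v \<in> lists ?AA" by (auto simp: padded_def)
  qed
  then have "regular ?AA (map (\<lambda>a. (None, Some a)) ` (T - {[]} - Range E))"
    using reg_roots by (rule regular_map[rotated])
  moreover have "?conv S = map (\<lambda>a. (None, Some a)) ` (T - {[]} - Range E) \<union> ?conv E"
    unfolding S_def convolution_Nil[symmetric] by blast
  ultimately have "regular_rel alphabet S"
    unfolding regular_rel_def using regular_Un[OF _ reg_E] TA ST by auto
  then show ?thesis
    unfolding automatic_def using finite_alphabet TA regular_T ST
    by (intro exI[of _ alphabet] exI[of _ T] exI[of _ S] exI[of _ id]) auto
qed

lemma E_stp: "(u, v) \<in> E \<Longrightarrow> (conf u, conf v) \<in> stp"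
proof (erule EE)
  fix h R d R'
  assume "u = enc h R" "v = enc (h @ [d]) R'" "d \<in> D" "node h R" "node (h @ [d]) R'"
    "snd (snd (last h)) = fst d" "sem m (fst (snd d)) R R'"
  then show "(conf u, conf v) \<in> stp"
    by (cases d) (auto simp: conf_enc config_step_def)
qed

lemma stp_E:
  assumes u: "u \<in> T - {[]}" and "(conf u, c) \<in> stp"
  shows "\<exists>v. (u, v) \<in> E \<and> conf v = c"
proof -
  obtain h R where h: "node h R" "h \<noteq> []" "u = enc h R" using u nonempty_node by blast
  then obtain a q' R' where a: "(snd (snd (last h)), a, q') \<in> D" "sem m a R R'" "c = (q', R')"
    using assms(2) by (auto simp: conf_enc config_step_def)
  let ?d = "(snd (snd (last h)), a, q')"
  \<comment> \<open>The additional history entry pays for the growth of the registers.\<close>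
  have "node (h @ [?d]) R'"
    using h(1) a sem_growth[OF a(2), of "length h"] D_registers[OF a(1,2)] unfolding node_def by auto
  moreover from this have "(u, enc (h @ [?d]) R') \<in> E_by ?d"
    unfolding E_by_def mem_Collect_eq using h a(2)
    by (intro exI[of _ h] exI[of _ R] exI[of _ R']) simp
  ultimately show ?thesis
    using a unfolding E_def by (intro exI[of _ "enc (h @ [?d]) R'"]) (auto simp: conf_enc)
qed

lemma conf_sibling:
  assumes "(u, v) \<in> E" "(u, v') \<in> E" "conf v = conf v'"
  shows "v = v'"
  using assms(1)
proof (rule EE)
  fix h1 R1 d1 R1'
  assume 1: "u = enc h1 R1" "v = enc (h1 @ [d1]) R1'" "d1 \<in> D" "node h1 R1" "node (h1 @ [d1]) R1'"
    "snd (snd (last h1)) = fst d1" "sem m (fst (snd d1)) R1 R1'"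
  show ?thesis using assms(2)
  proof (rule EE)
    fix h2 R2 d2 R2'
    assume 2: "u = enc h2 R2" "v' = enc (h2 @ [d2]) R2'" "d2 \<in> D" "node h2 R2" "node (h2 @ [d2]) R2'"
      "snd (snd (last h2)) = fst d2" "sem m (fst (snd d2)) R2 R2'"
    have eq: "h1 = h2" "R1 = R2" using enc_inject[of h1 R1 h2 R2] 1 2 by auto
    moreover have "R1' = R2'" "snd (snd d1) = snd (snd d2)" using 1 2 assms(3) by (auto simp: conf_enc)
    moreover have "d1 = d2"
    proof -
      obtain q a q' where d1: "d1 = (q, a, q')" by (cases d1)
      then obtain b where d2: "d2 = (q, b, q')" using 1 2 calculation by (cases d2) auto
      show ?thesis using D_unambiguous[of q a q' b R1 R1'] 1 2 calculation unfolding d1 d2 by simp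
    qed
    ultimately show "v = v'" using 1 2 by simp
  qed
qed

text \<open>Histories need not be consistent, so one transition into \<open>q'\<close>, repeated
  often enough to exceed the sum of the registers, makes room for any contents.\<close>

lemma conf_surj:
  assumes "(q, a, q') \<in> D" "\<And>i. k \<le> i \<Longrightarrow> R i = 0"
  shows "\<exists>w\<in>T - {[]}. conf w = (q', R)"
proof -
  let ?n = "Suc (\<Sum>i<k. R i)"
  let ?h = "replicate ?n (q, a, q')"
  have "R i \<le> ?n" for i
    using assms(2)[of i] member_le_sum[of i "{..<k}" R] by (cases "i < k") auto
  then have "node ?h R" unfolding node_def using assms by (auto simp del: replicate.simps)
  then have "enc ?h R \<in> T - {[]}" "conf (enc ?h R) = (q', R)"
    using nonempty_node[of "enc ?h R"] conf_enc[of ?h R]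
    by (simp_all add: last_replicate del: replicate.simps) (metis length_0_conv length_enc length_replicate nat.distinct(1))
  then show ?thesis by blast
qed

end

section \<open>The descent machine of a computable well-order\<close>

text \<open>Incrementing different registers always gives two distinct successors, so every
  \<open>Kernel\<close> configuration carries a binary tree. No other state leads into it.\<close>

definition kernel_trans :: "trans set" where
  "kernel_trans = {(Kernel, OInc 0, Kernel), (Kernel, OInc 1, Kernel)}"

fun instr_register :: "instr \<Rightarrow> nat" where
  "instr_register (Inc i l) = i"
| "instr_register (Dec i l l') = i"

text \<open>Capping jumps by \<open>min\<close> merges all exits from the program into the single
  state \<open>Prog n\<close>.\<close>

fun instr_trans :: "nat \<Rightarrow> nat \<Rightarrow> instr \<Rightarrow> trans set" where
  "instr_trans n pc (Inc i l) = {(Prog pc, OInc i, Prog (min l n))}"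
| "instr_trans n pc (Dec i l l') = {(Prog pc, ODec 0 i, Prog (min l n)), (Prog pc, OZero i, Prog (min l' n))}"

text \<open>\<open>ODec i i\<close> demands zeros below register \<open>i\<close>, so
  \<open>Clear\<close> always works on the lowest nonempty register and stays deterministic. From
  \<open>Prog n\<close> only a positive register 0, the verdict of \<open>p\<close>, leads on.
  \<open>Flush\<close> empties register \<open>m\<close> before \<open>OMove\<close> overwrites
  it.\<close>

definition control_trans :: "nat \<Rightarrow> nat \<Rightarrow> trans set" where
  "control_trans n m =
     {(Spine, OInc (Suc (Suc m)), Spine), (Spine, OGuess, Clear), (Clear, OInit, Prog 0),
      (Prog n, ODec 0 0, Flush), (Flush, ODec 0 m, Flush), (Flush, OMove, Spine)} \<union>
     {(Clear, ODec i i, Clear) | i. i < m}"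

definition machine :: "instr list \<Rightarrow> nat \<Rightarrow> trans set" where
  "machine p m = kernel_trans \<union> control_trans (length p) m \<union>
     (\<Union>pc<length p. instr_trans (length p) pc (p ! pc))"

lemma sem_ODec: "sem m (ODec n i) R R' \<longleftrightarrow> (\<forall>j<n. R j = 0) \<and> 0 < R i \<and> R' = R(i := R i - 1)"
  by (auto simp: fun_eq_iff)

lemma kernel_step_iff:
  assumes "\<And>a q'. (Kernel, a, q') \<in> D \<longleftrightarrow> (Kernel, a, q') \<in> kernel_trans"
  shows "((Kernel, R), c) \<in> config_step m D \<longleftrightarrow>
    c = (Kernel, R(0 := Suc (R 0))) \<or> c = (Kernel, R(1 := Suc (R 1)))"
  using assms
  by (cases c) (auto simp: config_step_def kernel_trans_def conj_disj_distribR ex_disj_distrib)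

lemma kernel_step_two:
  assumes "\<And>a q'. (Kernel, a, q') \<in> D \<longleftrightarrow> (Kernel, a, q') \<in> kernel_trans" "fst c = Kernel"
  shows "\<exists>c1\<in>{c. fst c = Kernel}. \<exists>c2\<in>{c. fst c = Kernel}.
    c1 \<noteq> c2 \<and> (c, c1) \<in> config_step m D \<and> (c, c2) \<in> config_step m D"
proof -
  obtain R where c: "c = (Kernel, R)" using assms(2) by (cases c) simp
  have "R(0 := Suc (R 0)) \<noteq> R(1 := Suc (R 1))"
    by (metis fun_upd_other fun_upd_same n_not_Suc_n zero_neq_one)
  then show ?thesis
    unfolding c using kernel_step_iff[of D R _ m] assms(1)
    by (intro bexI[of _ "(Kernel, R(0 := Suc (R 0)))"] bexI[of _ "(Kernel, R(1 := Suc (R 1)))"]) auto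
qed

locale order_machine =
  fixes p :: "instr list" and m :: nat and r :: "nat rel"
  assumes wo: "Well_order r" and Field_nonempty: "Field r \<noteq> {}" and m_ge_2: "2 \<le> m"
    and registers: "ins \<in> set p \<Longrightarrow> instr_register ins < m"
    and decides: "\<exists>n. let c = (step p ^^ n) (initial_config x y) in
        halted p c \<and> snd c 0 = (if (x, y) \<in> r then 1 else 0)"
begin

abbreviation D :: "trans set" where "D \<equiv> machine p m"
abbreviation stp :: "(state \<times> (nat \<Rightarrow> nat)) rel" where "stp \<equiv> config_step m D"
abbreviation X :: nat where "X \<equiv> m"
abbreviation Y :: nat where "Y \<equiv> Suc m"
abbreviation Z :: nat where "Z \<equiv> Suc (Suc m)"

lemma finite_machine: "finite D"
proof -
  have "finite (instr_trans n pc ins)" for n pc ins by (cases ins) auto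
  moreover have "{(Clear, ODec i i, Clear) | i. i < m} = (\<lambda>i. (Clear, ODec i i, Clear)) ` {..<m}" by auto
  ultimately show ?thesis by (simp add: machine_def kernel_trans_def control_trans_def)
qed

lemma instr_trans_source: "(q, a, q') \<in> instr_trans n pc ins \<Longrightarrow> q = Prog pc"
  by (cases ins) auto

lemma D_iff:
  "(Spine, a, q') \<in> D \<longleftrightarrow> a = OInc Z \<and> q' = Spine \<or> a = OGuess \<and> q' = Clear"
  "(Clear, a, q') \<in> D \<longleftrightarrow> a = OInit \<and> q' = Prog 0 \<or> (\<exists>i<m. a = ODec i i \<and> q' = Clear)"
  "(Flush, a, q') \<in> D \<longleftrightarrow> a = ODec 0 X \<and> q' = Flush \<or> a = OMove \<and> q' = Spine"
  "(Kernel, a, q') \<in> D \<longleftrightarrow> (Kernel, a, q') \<in> kernel_trans"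
  "(Prog pc, a, q') \<in> D \<longleftrightarrow> pc = length p \<and> a = ODec 0 0 \<and> q' = Flush \<or>
     pc < length p \<and> (Prog pc, a, q') \<in> instr_trans (length p) pc (p ! pc)"
  by (auto simp: machine_def kernel_trans_def control_trans_def dest: instr_trans_source)

lemma D_target_Kernel: "(q, a, Kernel) \<in> D \<Longrightarrow> q = Kernel"
proof (cases q)
  case (Prog pc)
  assume "(q, a, Kernel) \<in> D"
  then show ?thesis unfolding Prog D_iff by (cases "p ! pc") auto
qed (auto simp: D_iff)

lemma Spine_iff:
  "((Spine, R), c) \<in> stp \<longleftrightarrow> c = (Spine, R(Z := Suc (R Z))) \<or>
     R Y = 0 \<and> (\<exists>y\<le>R Z. c = (Clear, R(Y := y)))"
  by (auto simp: config_step_def D_iff)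

lemma Clear_iff:
  "((Clear, R), c) \<in> stp \<longleftrightarrow>
     (\<exists>i<m. (\<forall>j<i. R j = 0) \<and> 0 < R i \<and> c = (Clear, R(i := R i - 1))) \<or>
     (\<forall>j<m. R j = 0) \<and> R Y \<noteq> R X \<and> c = (Prog 0, R(0 := R Y, 1 := R X))"
  by (cases c) (auto simp: config_step_def D_iff sem_ODec simp del: sem.simps(2))

lemma Flush_iff:
  "((Flush, R), c) \<in> stp \<longleftrightarrow> 0 < R X \<and> c = (Flush, R(X := R X - 1)) \<or>
     R X = 0 \<and> c = (Spine, R(X := R Y, Y := 0))"
  by (cases c) (auto simp: config_step_def D_iff sem_ODec simp del: sem.simps(2))

lemma Halt_iff:
  "((Prog (length p), R), c) \<in> stp \<longleftrightarrow> 0 < R 0 \<and> c = (Flush, R(0 := R 0 - 1))"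
  by (cases c) (auto simp: config_step_def D_iff sem_ODec simp del: sem.simps(2))

lemma Prog_iff:
  assumes "pc < length p"
  shows "((Prog pc, R), c) \<in> stp \<longleftrightarrow> (case p ! pc of
      Inc i l \<Rightarrow> c = (Prog (min l (length p)), R(i := Suc (R i)))
    | Dec i l l' \<Rightarrow> if R i = 0 then c = (Prog (min l' (length p)), R)
        else c = (Prog (min l (length p)), R(i := R i - 1)))"
  using assms by (cases c; cases "p ! pc") (auto simp: config_step_def D_iff sem_ODec simp del: sem.simps(2))

lemma Prog_beyond: "length p < pc \<Longrightarrow> ((Prog pc, R), c) \<notin> stp"
  by (auto simp: config_step_def D_iff)

lemma stp_Kernel: "(c, c') \<in> stp \<Longrightarrow> fst c' = Kernel \<Longrightarrow> fst c = Kernel"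
  by (auto simp: config_step_def dest: D_target_Kernel)

text \<open>Determinism away from the spines keeps the ranks of unreachable configurations under control.\<close>

definition dstp :: "(state \<times> (nat \<Rightarrow> nat)) rel" where
  "dstp = {(c, c') \<in> stp. fst c \<noteq> Spine \<and> fst c \<noteq> Kernel}"

lemma single_valued_dstp: "single_valued dstp"
proof (rule single_valuedI)
  fix c c1 c2 assume "(c, c1) \<in> dstp" "(c, c2) \<in> dstp"
  then have 1: "(c, c1) \<in> stp" and 2: "(c, c2) \<in> stp" and q: "fst c \<noteq> Spine" "fst c \<noteq> Kernel"
    by (auto simp: dstp_def)
  obtain q R where c: "c = (q, R)" by (cases c)
  show "c1 = c2"
  proof (cases q)
    case Clear
    have "i = j" if "\<forall>l<i. R l = 0" "0 < R i" "\<forall>l<j. R l = 0" "0 < R j" for i j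
      using that by (metis linorder_neqE_nat not_less_zero)
    then show ?thesis using 1 2 unfolding c Clear Clear_iff by auto
  next
    case (Prog pc)
    show ?thesis
    proof (cases "pc < length p")
      case True
      then show ?thesis using 1 2 unfolding c Prog Prog_iff[OF True] by (auto split: instr.splits if_splits)
    next
      case False
      then have "pc = length p" using 1 Prog_beyond[of pc R c1] unfolding c Prog by linarith
      then show ?thesis using 1 2 unfolding c Prog by (simp add: Halt_iff)
    qed
  next
    case Flush
    then show ?thesis using 1 2 unfolding c Flush Flush_iff by auto
  qed (use q c in auto)
qed

lemma dstp_unique: "(c, c1) \<in> dstp \<Longrightarrow> (c, c2) \<in> dstp \<Longrightarrow> c1 = c2"
  using single_valued_dstp by (rule single_valuedD)

lemma Spine_no_dstp: "((Spine, R), c) \<notin> dstp"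
  by (simp add: dstp_def)

lemma dstpI: "((q, R), c) \<in> stp \<Longrightarrow> q \<noteq> Spine \<Longrightarrow> q \<noteq> Kernel \<Longrightarrow> ((q, R), c) \<in> dstp"
  by (simp add: dstp_def)

section \<open>Deterministic phases between two spines\<close>

lemma clear_registers: "((Clear, R), (Clear, \<lambda>i. if i < m then 0 else R i)) \<in> dstp\<^sup>*"
proof (induction "\<Sum>i<m. R i" arbitrary: R rule: less_induct)
  case less
  show ?case
  proof (cases "\<forall>i<m. R i = 0")
    case True
    then have "(\<lambda>i. if i < m then 0 else R i) = R" by auto
    then show ?thesis by simp
  next
    case False
    then have ex: "\<exists>i. i < m \<and> 0 < R i" by auto
    \<comment> \<open>The least nonempty work register is the one whose decrement is enabled in
      \<open>Clear\<close>.\<close>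
    define i where "i = (LEAST i. i < m \<and> 0 < R i)"
    have i: "i < m" "0 < R i" using LeastI_ex[OF ex] unfolding i_def by auto
    have "R j = 0" if "j < i" for j
      using not_less_Least[of j "\<lambda>i. i < m \<and> 0 < R i"] that i(1) unfolding i_def by auto
    then have step: "((Clear, R), (Clear, R(i := R i - 1))) \<in> dstp"
      using i by (intro dstpI) (auto simp: Clear_iff)
    have "(\<Sum>j<m. (R(i := R i - 1)) j) < (\<Sum>j<m. R j)"
      using i by (intro sum_strict_mono_ex1) auto
    from less[OF this] have "((Clear, R(i := R i - 1)), (Clear, \<lambda>j. if j < m then 0 else (R(i := R i - 1)) j)) \<in> dstp\<^sup>*" .
    moreover have "(\<lambda>j. if j < m then 0 else (R(i := R i - 1)) j) = (\<lambda>j. if j < m then 0 else R j)"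
      using i by auto
    ultimately show ?thesis using step by (simp add: converse_rtrancl_into_rtrancl)
  qed
qed

text \<open>The \<open>min\<close> accounts for the capped jumps. Registers from \<open>m\<close> on
  keep the guess, the current element and the height, since \<open>p\<close> addresses only
  registers below \<open>m\<close>.\<close>

lemma simulation:
  assumes R: "\<And>i. i < m \<Longrightarrow> R i = snd (initial_config x y) i"
  shows "\<exists>R'. ((Prog 0, R), (Prog (min (fst ((step p ^^ n) (initial_config x y))) (length p)), R')) \<in> dstp\<^sup>* \<and>
    (\<forall>i<m. R' i = snd ((step p ^^ n) (initial_config x y)) i) \<and> (\<forall>i\<ge>m. R' i = R i)"
proof (induction n)
  case 0
  then show ?case using R by (intro exI[of _ R]) (simp add: initial_config_def)
next
  case (Suc n)
  obtain pc Q where c: "(step p ^^ n) (initial_config x y) = (pc, Q)" by fastforce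
  obtain R' where R': "((Prog 0, R), (Prog (min pc (length p)), R')) \<in> dstp\<^sup>*"
    "\<And>i. i < m \<Longrightarrow> R' i = Q i" "\<And>i. m \<le> i \<Longrightarrow> R' i = R i"
    using Suc c by auto
  show ?case
  proof (cases "length p \<le> pc")
    case True
    then have "(step p ^^ Suc n) (initial_config x y) = (pc, Q)" using c by (simp add: halted_def)
    then show ?thesis using R' by auto
  next
    case False
    then have pc: "pc < length p" by simp
    have reg: "instr_register (p ! pc) < m" using pc registers by simp
    have "\<exists>pc' Q' R''. step p (pc, Q) = (pc', Q') \<and>
       ((Prog pc, R'), (Prog (min pc' (length p)), R'')) \<in> stp \<and>
       (\<forall>i<m. R'' i = Q' i) \<and> (\<forall>i\<ge>m. R'' i = R' i)"
    proof (cases "p ! pc")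
      case (Inc i l)
      then show ?thesis using pc reg R'(2)
        by (intro exI[of _ l] exI[of _ "Q(i := Suc (Q i))"] exI[of _ "R'(i := Suc (R' i))"])
          (auto simp: halted_def Prog_iff[OF pc])
    next
      case (Dec i l l')
      show ?thesis
      proof (cases "Q i = 0")
        case True
        then show ?thesis using pc reg R'(2) Dec
          by (intro exI[of _ l'] exI[of _ Q] exI[of _ R']) (auto simp: halted_def Prog_iff[OF pc])
      next
        case False
        then show ?thesis using pc reg R'(2) Dec
          by (intro exI[of _ l] exI[of _ "Q(i := Q i - 1)"] exI[of _ "R'(i := R' i - 1)"])
            (auto simp: halted_def Prog_iff[OF pc])
      qed
    qed
    then obtain pc' Q' R'' where s: "step p (pc, Q) = (pc', Q')"
      "((Prog pc, R'), (Prog (min pc' (length p)), R'')) \<in> stp"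
      "\<And>i. i < m \<Longrightarrow> R'' i = Q' i" "\<And>i. m \<le> i \<Longrightarrow> R'' i = R' i" by blast
    have "((Prog 0, R), (Prog (min pc' (length p)), R'')) \<in> dstp\<^sup>*"
      using R'(1) s(2) pc by (simp add: min_absorb1 dstpI rtrancl_into_rtrancl)
    moreover have "(step p ^^ Suc n) (initial_config x y) = (pc', Q')" using c s(1) by simp
    ultimately show ?thesis using s(3,4) R'(3) by auto
  qed
qed

lemma flush_X: "((Flush, R), (Flush, R(X := 0))) \<in> dstp\<^sup>*"
proof (induction "R X" arbitrary: R)
  case 0
  then have "R(X := 0) = R" by auto
  then show ?case by simp
next
  case (Suc n)
  have "((Flush, R), (Flush, R(X := n))) \<in> dstp"
    using Suc(2)[symmetric] by (intro dstpI) (auto simp: Flush_iff)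
  moreover have "((Flush, R(X := n)), (Flush, R(X := 0))) \<in> dstp\<^sup>*"
    using Suc(1)[of "R(X := n)"] by simp
  ultimately show ?case by (rule converse_rtrancl_into_rtrancl)
qed

lemma verdict:
  assumes "R Y \<noteq> R X"
  shows "\<exists>R'. ((Clear, R), (Prog (length p), R')) \<in> dstp\<^sup>* \<and>
    R' 0 = (if (R Y, R X) \<in> r then 1 else 0) \<and> (\<forall>i\<ge>m. R' i = R i)"
proof -
  let ?R1 = "\<lambda>i. if i < m then 0 else R i"
  let ?R2 = "?R1(0 := R Y, 1 := R X)"
  let ?c = "initial_config (R Y) (R X)"
  obtain n where n: "halted p ((step p ^^ n) ?c)" "snd ((step p ^^ n) ?c) 0 = (if (R Y, R X) \<in> r then 1 else 0)"
    using decides[of "R Y" "R X"] unfolding Let_def by blast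
  have "((Clear, ?R1), (Prog 0, ?R2)) \<in> dstp"
    using assms by (intro dstpI) (auto simp: Clear_iff)
  with clear_registers[of R] have 1: "((Clear, R), (Prog 0, ?R2)) \<in> dstp\<^sup>*"
    by (rule rtrancl_into_rtrancl)
  have "?R2 i = snd ?c i" if "i < m" for i using that by (simp add: initial_config_def)
  from simulation[OF this, of n] obtain R' where
    R': "((Prog 0, ?R2), (Prog (min (fst ((step p ^^ n) ?c)) (length p)), R')) \<in> dstp\<^sup>*"
    "\<forall>i<m. R' i = snd ((step p ^^ n) ?c) i" "\<forall>i\<ge>m. R' i = ?R2 i" by blast
  have "min (fst ((step p ^^ n) ?c)) (length p) = length p" using n(1) unfolding halted_def by simp
  then have "((Clear, R), (Prog (length p), R')) \<in> dstp\<^sup>*" using 1 R'(1) by simp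
  moreover have "R' 0 = (if (R Y, R X) \<in> r then 1 else 0)" using R'(2) n(2) m_ge_2 by auto
  moreover have "\<forall>i\<ge>m. R' i = R i" using R'(3) m_ge_2 by auto
  ultimately show ?thesis by blast
qed

lemma accepting:
  assumes "(R Y, R X) \<in> r" "R Y \<noteq> R X"
  shows "\<exists>R'. ((Clear, R), (Spine, R')) \<in> dstp\<^sup>* \<and> R' X = R Y \<and> R' Y = 0"
proof -
  obtain R' where R': "((Clear, R), (Prog (length p), R')) \<in> dstp\<^sup>*" "R' 0 = 1" "\<forall>i\<ge>m. R' i = R i"
    using verdict[OF assms(2)] assms(1) by auto
  let ?R1 = "R'(0 := 0)"
  let ?R2 = "?R1(X := 0)"
  let ?R3 = "?R2(X := ?R2 Y, Y := 0)"
  have "((Prog (length p), R'), (Flush, ?R1)) \<in> dstp"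
    using R'(2) by (intro dstpI) (auto simp: Halt_iff)
  moreover have "((Flush, ?R2), (Spine, ?R3)) \<in> dstp"
    by (intro dstpI) (auto simp: Flush_iff)
  ultimately have "((Clear, R), (Spine, ?R3)) \<in> dstp\<^sup>*"
    using R'(1) flush_X[of ?R1] by (meson rtrancl_into_rtrancl rtrancl_trans)
  moreover have "?R3 X = R Y" "?R3 Y = 0" using R'(3) m_ge_2 by auto
  ultimately show ?thesis by blast
qed

text \<open>Since \<open>r\<close> is reflexive on its field, \<open>p\<close> would accept equal
  elements; the guard of \<open>OInit\<close> stops these before \<open>p\<close> is started.
  Otherwise verdict 0 blocks the exit from \<open>Prog (length p)\<close>.\<close>

lemma rejecting:
  assumes "\<not> ((R Y, R X) \<in> r \<and> R Y \<noteq> R X)"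
  shows "\<exists>s. ((Clear, R), s) \<in> dstp\<^sup>* \<and> s \<notin> Domain stp"
proof (cases "R Y = R X")
  case True
  let ?R1 = "\<lambda>i. if i < m then 0 else R i"
  have "(Clear, ?R1) \<notin> Domain stp" using True by (auto simp: Clear_iff)
  then show ?thesis using clear_registers by blast
next
  case False
  obtain R' where R': "((Clear, R), (Prog (length p), R')) \<in> dstp\<^sup>*" "R' 0 = 0"
    using verdict[OF False] assms False by auto
  then have "(Prog (length p), R') \<notin> Domain stp" by (auto simp: Halt_iff)
  then show ?thesis using R'(1) by blast
qed

section \<open>Ranks of configurations\<close>

definition bottom :: nat where
  "bottom = wo_rel.minim r (Field r)"

lemma bottom: "bottom \<in> Field r" "x \<in> Field r \<Longrightarrow> (bottom, x) \<in> r"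
  using wo Field_nonempty unfolding bottom_def
  by (auto intro!: wo_rel.minim_in wo_rel.minim_least simp: wo_rel_def)

lemma order: "trans r" "antisym r" "x \<in> Field r \<Longrightarrow> (x, x) \<in> r"
  using wo by (auto simp: order_on_defs refl_on_def)

text \<open>If \<open>R Y \<noteq> 0\<close> no guess is enabled, and if \<open>R X\<close> is
  outside the field every guess is rejected. Such a spine carries a single infinite run and so gets
  the least rank.\<close>

definition spine_rank :: "(nat \<Rightarrow> nat) \<Rightarrow> nat" where
  "spine_rank R = (if R Y = 0 \<and> R X \<in> Field r then R X else bottom)"

text \<open>The deterministic evolution leads to at most one spine, whose rank is inherited. A
  non-\<open>Kernel\<close> configuration that gets stuck or runs forever without reaching a spine
  has at most one infinite run, which justifies the default \<open>bottom\<close>.\<close>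

definition rank :: "state \<times> (nat \<Rightarrow> nat) \<Rightarrow> nat" where
  "rank c = (if \<exists>R. (c, (Spine, R)) \<in> dstp\<^sup>* then spine_rank (THE R. (c, (Spine, R)) \<in> dstp\<^sup>*) else bottom)"

lemma dstp_end_unique:
  assumes "(c, s) \<in> dstp\<^sup>*" "s \<notin> Domain dstp" "(c, t) \<in> dstp\<^sup>*" "t \<notin> Domain dstp"
  shows "s = t"
  using single_valued_confluent[OF single_valued_dstp assms(1,3)] assms(2,4)
  by (metis DomainI converse_rtranclE)

lemma Spine_end: "(Spine, R) \<notin> Domain dstp"
  using Spine_no_dstp by blast

lemma rank_reach:
  assumes "(c, (Spine, R)) \<in> dstp\<^sup>*"
  shows "rank c = spine_rank R"
proof -
  have "(THE R. (c, (Spine, R)) \<in> dstp\<^sup>*) = R"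
    using assms dstp_end_unique[OF _ Spine_end _ Spine_end] by (intro the_equality) blast+
  then show ?thesis unfolding rank_def using assms by auto
qed

lemma rank_Spine: "rank (Spine, R) = spine_rank R"
  by (rule rank_reach) simp

lemma rank_dstp:
  assumes "(c, c') \<in> dstp"
  shows "rank c = rank c'"
proof (cases "\<exists>R. (c, (Spine, R)) \<in> dstp\<^sup>*")
  case True
  then obtain R where R: "(c, (Spine, R)) \<in> dstp\<^sup>*" by blast
  have "c \<noteq> (Spine, R)" using assms Spine_no_dstp by blast
  then have "(c', (Spine, R)) \<in> dstp\<^sup>*"
    using R assms dstp_unique by (metis converse_rtranclE)
  then show ?thesis using R by (simp add: rank_reach)
next
  case False
  then have "\<nexists>R. (c', (Spine, R)) \<in> dstp\<^sup>*" using assms by (meson converse_rtrancl_into_rtrancl)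
  then show ?thesis using False unfolding rank_def by simp
qed

lemma rank_in_Field: "rank c \<in> Field r"
  using bottom(1) unfolding rank_def spine_rank_def by auto

lemma rank_stuck:
  assumes "(c, s) \<in> dstp\<^sup>*" "s \<notin> Domain stp"
  shows "rank c = bottom"
proof -
  have "s \<notin> Domain dstp" using assms(2) unfolding dstp_def by blast
  moreover have "s \<noteq> (Spine, R)" for R using assms(2) by (auto simp: Spine_iff)
  ultimately have "(c, (Spine, R)) \<notin> dstp\<^sup>*" for R
    using dstp_end_unique[OF assms(1) _ _ Spine_end] by blast
  then show ?thesis unfolding rank_def by simp
qed

lemma stuck_no_run:
  assumes "(c, s) \<in> dstp\<^sup>*" "s \<notin> Domain stp"
  shows "\<not> infinite_run stp L c f"
  using assms(1)
proof (induction arbitrary: f rule: converse_rtrancl_induct)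
  case base
  then show ?case using assms(2) unfolding infinite_run_def by blast
next
  case (step c c')
  show ?case
  proof
    assume f: "infinite_run stp L c f"
    then have "(c, f 1) \<in> dstp" using step(1) unfolding infinite_run_def dstp_def by force
    then have "f 1 = c'" using step(1) dstp_unique by blast
    then have "infinite_run stp L c' (\<lambda>i. f (Suc i))" using f unfolding infinite_run_def by simp
    then show False using step.IH by blast
  qed
qed

lemma rank_guess:
  "rank (Clear, R) = (if (R Y, R X) \<in> r \<and> R Y \<noteq> R X then R Y else bottom)"
proof (cases "(R Y, R X) \<in> r \<and> R Y \<noteq> R X")
  case True
  then obtain R' where "((Clear, R), (Spine, R')) \<in> dstp\<^sup>*" "R' X = R Y" "R' Y = 0"
    using accepting by blast
  moreover have "R Y \<in> Field r" using True by (auto simp: Field_def)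
  ultimately show ?thesis using True rank_reach by (simp add: spine_rank_def)
next
  case False
  then show ?thesis using rejecting[OF False] rank_stuck by auto
qed

text \<open>Only a guess can change the rank: it leads to an element strictly below the current one
  if accepted, and to \<open>bottom\<close> if rejected or disallowed.\<close>

lemma rank_stp:
  assumes "(c, c') \<in> stp" "fst c \<noteq> Kernel"
  shows "(rank c', rank c) \<in> r"
proof (cases "fst c = Spine")
  case False
  then have "(c, c') \<in> dstp" using assms unfolding dstp_def by simp
  then show ?thesis using rank_dstp rank_in_Field order(3) by metis
next
  case True
  then obtain R where c: "c = (Spine, R)" by (cases c) simp
  consider "c' = (Spine, R(Z := Suc (R Z)))" | y where "R Y = 0" "c' = (Clear, R(Y := y))"
    using assms(1) unfolding c Spine_iff by blast
  then show ?thesis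
  proof cases
    case 1
    then have "rank c' = rank c" unfolding c by (simp add: rank_Spine spine_rank_def)
    then show ?thesis using rank_in_Field order(3) by metis
  next
    case 2
    have "(y, rank c) \<in> r" if "(y, R X) \<in> r"
    proof -
      have "R X \<in> Field r" using that by (auto simp: Field_def)
      then show ?thesis using that 2 unfolding c by (simp add: rank_Spine spine_rank_def)
    qed
    then show ?thesis using 2 bottom(2)[OF rank_in_Field] by (auto simp: rank_guess)
  qed
qed

section \<open>Counting infinite runs above a given rank\<close>

lemma spine_run:
  assumes "\<And>n. (Spine, R(Z := n)) \<in> L"
  shows "infinite_run stp L (Spine, R) (\<lambda>i. (Spine, R(Z := R Z + i)))"
  using assms unfolding infinite_run_def by (simp add: Spine_iff)

text \<open>The rank is constant along \<open>dstp\<close>, so prefixing a deterministic segment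
  never leaves a set that contains all configurations of that rank.\<close>

lemma run_back:
  assumes "(c, c') \<in> dstp\<^sup>*" "infinite_run stp L c' f" "\<And>d. rank d = rank c' \<Longrightarrow> d \<in> L"
  shows "\<exists>f. infinite_run stp L c f"
proof -
  have "rank c = rank c' \<and> (\<exists>f. infinite_run stp L c f)"
    using assms(1)
  proof (induction rule: converse_rtrancl_induct)
    case base
    then show ?case using assms(2) by blast
  next
    case (step d d')
    have "rank d = rank c'" using step rank_dstp by simp
    moreover have "(d, d') \<in> stp" using step(1) unfolding dstp_def by blast
    ultimately show ?case using step.IH assms(3) infinite_run_Cons[of d L d'] by blast
  qed
  then show ?thesis by blast
qed

lemma two_runs_Cons:
  assumes "\<exists>f g. infinite_run stp L c' f \<and> infinite_run stp L c' g \<and> f \<noteq> g" "(c, c') \<in> stp" "c \<in> L"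
  shows "\<exists>f g. infinite_run stp L c f \<and> infinite_run stp L c g \<and> f \<noteq> g"
proof -
  obtain f g where fg: "infinite_run stp L c' f" "infinite_run stp L c' g" "f \<noteq> g" using assms(1) by blast
  then obtain i where "f i \<noteq> g i" by blast
  then have "case_nat c f (Suc i) \<noteq> case_nat c g (Suc i)" by simp
  then have "case_nat c f \<noteq> case_nat c g" by metis
  then show ?thesis using infinite_run_Cons[OF assms(3,2)] fg by blast
qed

lemma two_runs_back:
  assumes "(c, c') \<in> dstp\<^sup>*" "\<exists>f g. infinite_run stp L c' f \<and> infinite_run stp L c' g \<and> f \<noteq> g"
    "\<And>d. rank d = rank c' \<Longrightarrow> d \<in> L"
  shows "\<exists>f g. infinite_run stp L c f \<and> infinite_run stp L c g \<and> f \<noteq> g"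
proof -
  have "rank c = rank c' \<and> (\<exists>f g. infinite_run stp L c f \<and> infinite_run stp L c g \<and> f \<noteq> g)"
    using assms(1)
  proof (induction rule: converse_rtrancl_induct)
    case base
    then show ?case using assms(2) by blast
  next
    case (step d d')
    have "rank d = rank c'" using step rank_dstp by simp
    moreover have "(d, d') \<in> stp" using step(1) unfolding dstp_def by blast
    ultimately show ?case using step.IH assms(3) two_runs_Cons[of L d' d] by blast
  qed
  then show ?thesis by blast
qed

text \<open>One run climbs forever; the other guesses \<open>x\<close> itself and then climbs the
  spine of \<open>x\<close>, at rank \<open>x\<close> throughout. The induction, on a difference of
  natural numbers unrelated to \<open>r\<close>, climbs to height \<open>x\<close>, where this guess
  becomes available.\<close>

lemma spine_two_runs:
  assumes "R Y = 0" "(x, R X) \<in> r" "x \<noteq> R X"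
  shows "\<exists>f g. infinite_run stp {c. (x, rank c) \<in> r} (Spine, R) f \<and>
    infinite_run stp {c. (x, rank c) \<in> r} (Spine, R) g \<and> f \<noteq> g"
  using assms
proof (induction "x - R Z" arbitrary: R)
  case (Suc n)
  let ?R = "R(Z := Suc (R Z))"
  have "R X \<in> Field r" using Suc by (auto simp: Field_def)
  then have "(x, rank (Spine, R)) \<in> r" using Suc by (simp add: rank_Spine spine_rank_def)
  have "n = x - ?R Z" using Suc(2) by simp
  then have two: "\<exists>f g. infinite_run stp {c. (x, rank c) \<in> r} (Spine, ?R) f \<and>
    infinite_run stp {c. (x, rank c) \<in> r} (Spine, ?R) g \<and> f \<noteq> g"
    using Suc(3-5) by (intro Suc(1)) auto
  show ?case
    by (rule two_runs_Cons[OF two]) (use \<open>(x, rank (Spine, R)) \<in> r\<close> in \<open>auto simp: Spine_iff\<close>)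
next
  case 0
  let ?L = "{c. (x, rank c) \<in> r}"
  let ?G = "R(Y := x)"
  have F: "R X \<in> Field r" "x \<in> Field r" using 0 by (auto simp: Field_def)
  have L: "(Spine, R(Z := n)) \<in> ?L" for n using 0 F by (simp add: rank_Spine spine_rank_def)
  have f: "infinite_run stp ?L (Spine, R) (\<lambda>i. (Spine, R(Z := R Z + i)))"
    using L by (rule spine_run)
  have rank_G: "rank (Clear, ?G) = x" using 0 by (simp add: rank_guess)
  obtain R' where R': "((Clear, ?G), (Spine, R')) \<in> dstp\<^sup>*" "R' X = x" "R' Y = 0"
    using accepting[of ?G] 0 by auto
  have rank_R': "rank (Spine, R'(Z := n)) = x" for n
    using R' F by (simp add: rank_Spine spine_rank_def)
  then have run': "infinite_run stp ?L (Spine, R') (\<lambda>i. (Spine, R'(Z := R' Z + i)))"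
    using order(3)[OF F(2)] by (intro spine_run) simp
  have "rank (Spine, R') = x" using rank_R'[of "R' Z"] by simp
  then have "\<exists>g. infinite_run stp ?L (Clear, ?G) g"
    by (intro run_back[OF R'(1) run']) (use order(3)[OF F(2)] in simp)
  then obtain g where g: "infinite_run stp ?L (Clear, ?G) g" by blast
  have "(Spine, R) \<in> ?L" using L[of "R Z"] by simp
  moreover have "((Spine, R), (Clear, ?G)) \<in> stp" using 0 by (auto simp: Spine_iff)
  ultimately have g': "infinite_run stp ?L (Spine, R) (case_nat (Spine, R) g)"
    using g by (rule infinite_run_Cons)
  have "fst (case_nat (Spine, R) g 1) = Clear" using g unfolding infinite_run_def by simp
  then have "(\<lambda>i. (Spine, R(Z := R Z + i))) \<noteq> case_nat (Spine, R) g" by (metis fst_conv state.distinct(1))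
  then show ?case using f g' by blast
qed

text \<open>A rank with something strictly below it is not \<open>bottom\<close>, so it stems from a
  spine with a usable \<open>R X\<close>, and the two runs found there are pulled back.\<close>

lemma rank_two_runs:
  assumes "(x, rank c) \<in> r" "x \<noteq> rank c"
  shows "\<exists>f g. infinite_run stp {c. (x, rank c) \<in> r} c f \<and>
    infinite_run stp {c. (x, rank c) \<in> r} c g \<and> f \<noteq> g"
proof -
  have "x \<in> Field r" using assms(1) by (auto simp: Field_def)
  then have "rank c \<noteq> bottom" using assms bottom(2) order(2) by (metis antisymD)
  then obtain R where R: "(c, (Spine, R)) \<in> dstp\<^sup>*" unfolding rank_def by metis
  then have "rank c = spine_rank R" by (rule rank_reach)
  then have "R Y = 0" "rank c = R X" using \<open>rank c \<noteq> bottom\<close> unfolding spine_rank_def by metis+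
  then show ?thesis
    using assms two_runs_back[OF R spine_two_runs[of R x]] \<open>rank c = spine_rank R\<close>
    by (simp add: rank_Spine)
qed

lemma run_rank_le:
  assumes "infinite_run stp L c f" "fst c \<noteq> Kernel"
  shows "fst (f i) \<noteq> Kernel \<and> (rank (f i), rank c) \<in> r"
proof (induction i)
  case 0
  then show ?case using assms rank_in_Field order(3) unfolding infinite_run_def by metis
next
  case (Suc i)
  have "(f i, f (Suc i)) \<in> stp" using assms(1) unfolding infinite_run_def by blast
  then show ?case using Suc stp_Kernel rank_stp order(1) by (meson transD)
qed

text \<open>
  Leaving a spine never preserves the rank: an accepted guess is strictly smaller, and a rejected
  one admits no infinite run, although its rank is \<open>bottom\<close> by convention.
\<close>

lemma run_no_guess:
  assumes f: "infinite_run stp {c'. (rank c, rank c') \<in> r} c f" and "fst c \<noteq> Kernel"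
    and j: "f j = (Spine, R)" "R Y = 0" "f (Suc j) = (Clear, R(Y := y))"
  shows False
proof (cases "(y, R X) \<in> r \<and> y \<noteq> R X")
  case True
  then have "R X \<in> Field r" by (auto simp: Field_def)
  then have "rank (f j) = R X" "rank (f (Suc j)) = y"
    using True j by (simp_all add: rank_Spine spine_rank_def rank_guess)
  moreover have "(rank (f j), rank c) \<in> r" using run_rank_le[OF f assms(2)] by blast
  moreover have "(rank c, rank (f (Suc j))) \<in> r" using f unfolding infinite_run_def by blast
  ultimately have "(R X, y) \<in> r" using order(1) by (metis transD)
  then show False using True order(2) by (metis antisymD)
next
  case False
  then obtain s where "(f (Suc j), s) \<in> dstp\<^sup>*" "s \<notin> Domain stp"
    using rejecting[of "R(Y := y)"] j by auto
  moreover have "infinite_run stp UNIV (f (Suc j)) (\<lambda>i. f (Suc j + i))"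
    using f unfolding infinite_run_def by simp
  ultimately show False using stuck_no_run by blast
qed

text \<open>Outside \<open>Kernel\<close> runs can branch only on a spine, and there
  \<open>run_no_guess\<close> forces the climb.\<close>

lemma rank_one_run:
  assumes "fst c \<noteq> Kernel" and f: "infinite_run stp {c'. (rank c, rank c') \<in> r} c f"
    and g: "infinite_run stp {c'. (rank c, rank c') \<in> r} c g"
  shows "f = g"
proof
  fix i
  show "f i = g i"
  proof (induction i)
    case 0
    then show ?case using f g unfolding infinite_run_def by simp
  next
    case (Suc j)
    have f_step: "(f j, f (Suc j)) \<in> stp" and g_step: "(f j, g (Suc j)) \<in> stp"
      using f g Suc unfolding infinite_run_def by metis+
    have "fst (f j) \<noteq> Kernel" using run_rank_le[OF f assms(1)] by blast
    show ?case
    proof (cases "fst (f j) = Spine")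
      case False
      then show ?thesis using f_step g_step \<open>fst (f j) \<noteq> Kernel\<close> dstp_unique unfolding dstp_def by blast
    next
      case True
      then obtain R where R: "f j = (Spine, R)" by (cases "f j") simp
      have "f (Suc j) = (Spine, R(Z := Suc (R Z)))"
        using f_step run_no_guess[OF f assms(1) R] unfolding R Spine_iff by blast
      moreover have "g (Suc j) = (Spine, R(Z := Suc (R Z)))"
        using g_step run_no_guess[OF g assms(1)] Suc R unfolding R Spine_iff by metis
      ultimately show ?thesis by simp
    qed
  qed
qed

lemma D_registers:
  assumes "(q, a, q') \<in> D" "sem m a R R'" "m + 3 \<le> i"
  shows "R' i = R i"
proof -
  have instr: "R' i = R i" if "(Prog pc, a, q') \<in> instr_trans n pc ins" "instr_register ins < m" for n pc ins
    using that assms(2,3) by (cases ins) (auto simp: fun_eq_iff)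
  show ?thesis
  proof (cases q)
    case (Prog pc)
    then show ?thesis
      using assms instr[of pc "length p" "p ! pc"] registers[of "p ! pc"] by (auto simp: D_iff fun_eq_iff)
  next
    case Kernel
    then show ?thesis using assms m_ge_2 by (auto simp: D_iff kernel_trans_def)
  qed (use assms m_ge_2 in \<open>auto simp: D_iff fun_eq_iff\<close>)
qed

text \<open>Competing operations between the same two states have exclusive guards or different
  results. The case is real: both branches of a \<open>Dec\<close> may jump to the same label, and
  \<open>Clear\<close> has one loop per work register.\<close>

lemma D_unambiguous:
  assumes "(q, a, q') \<in> D" "(q, b, q') \<in> D" "sem m a R R'" "sem m b R R'"
  shows "a = b"
proof (cases q)
  case Clear
  show ?thesis
  proof (cases q')
    case (Prog n)
    then show ?thesis using assms Clear by (auto simp: D_iff)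
  next
    case clear: Clear
    then obtain i j where ij: "a = ODec i i" "b = ODec j j" using assms Clear by (auto simp: D_iff)
    have "i = j"
      using assms(3,4) unfolding ij sem_ODec by (metis linorder_neqE_nat not_less_zero)
    then show ?thesis using ij by simp
  qed (use assms Clear in \<open>auto simp: D_iff\<close>)
next
  case (Prog pc)
  show ?thesis
  proof (cases "pc < length p")
    case True
    then show ?thesis
      using assms Prog by (cases "p ! pc") (auto simp: D_iff sem_ODec fun_eq_iff simp del: sem.simps(2))
  next
    case False
    then show ?thesis using assms Prog by (auto simp: D_iff)
  qed
next
  case Kernel
  have "R(0 := Suc (R 0)) \<noteq> R(1 := Suc (R 1))"
    by (metis fun_upd_other fun_upd_same n_not_Suc_n zero_neq_one)
  then show ?thesis using assms Kernel by (auto simp: D_iff kernel_trans_def)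
qed (use assms in \<open>auto simp: D_iff\<close>)

end

lemma ex_code:
  assumes "finite (D :: trans set)"
  shows "\<exists>code :: trans \<times> nat set \<Rightarrow> nat. inj_on code (D \<times> Pow {..<k})"
proof -
  have "finite (D \<times> Pow {..<k})" using assms by simp
  then show ?thesis using finite_imp_inj_to_nat_seg by metis
qed

lemma (in order_machine) automatic_tree_of_rank:
  assumes "\<alpha> =o r"
  shows "\<exists>(T :: nat list set) (S :: nat list rel).
    successor_tree T S \<and> automatic T S \<and> has_CB_rank T (tree_order T S) \<alpha>"
proof -
  \<comment> \<open>The tracks are those of the \<open>m\<close> work registers and of
    \<open>X\<close>, \<open>Y\<close> and \<open>Z\<close>.\<close>
  obtain code :: "trans \<times> nat set \<Rightarrow> nat" where code: "inj_on code (D \<times> Pow {..<m + 3})"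
    using ex_code[OF finite_machine] by blast
  interpret ct: counter_tree m "m + 3" D code
    by unfold_locales (fact finite_machine code m_ge_2 D_registers D_unambiguous)+
  interpret rf: ranked_forest ct.T "[]" ct.E length ct.conf stp "{c. fst c = Kernel}" r rank
  proof unfold_locales
    show "(ct.conf u, ct.conf v) \<in> stp" if "(u, v) \<in> ct.E" for u v
      using that by (rule ct.E_stp)
    show "\<exists>v. (u, v) \<in> ct.E \<and> ct.conf v = c" if "u \<in> ct.T - {[]}" "(ct.conf u, c) \<in> stp" for u c
      using that by (rule ct.stp_E)
    show "v = v'" if "(u, v) \<in> ct.E" "(u, v') \<in> ct.E" "ct.conf v = ct.conf v'" for u v v'
      using that by (rule ct.conf_sibling)
    have "(Kernel, OInc 0, Kernel) \<in> D" by (simp add: D_iff kernel_trans_def)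
    then show "\<exists>w\<in>ct.T - {[]}. ct.conf w \<in> {c. fst c = Kernel}"
      by (auto dest!: ct.conf_surj[of Kernel "OInc 0" Kernel "\<lambda>_. 0", OF _ refl] intro: bexI[rotated])
    show "\<exists>c1\<in>{c. fst c = Kernel}. \<exists>c2\<in>{c. fst c = Kernel}. c1 \<noteq> c2 \<and> (c, c1) \<in> stp \<and> (c, c2) \<in> stp"
      if "c \<in> {c. fst c = Kernel}" for c
      using that by (intro kernel_step_two) (simp_all add: D_iff)
    show "c \<in> {c. fst c = Kernel}" if "(c, c') \<in> stp" "c' \<in> {c. fst c = Kernel}" for c c'
      using that stp_Kernel by simp
    show "Well_order r" by (rule wo)
    show "rank c \<in> Field r" for c by (rule rank_in_Field)
    show "(rank c', rank c) \<in> r" if "(c, c') \<in> stp" "c \<notin> {c. fst c = Kernel}" for c c'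
      using that by (intro rank_stp) auto
    show "\<exists>f g. infinite_run stp {c. (x, rank c) \<in> r} c f \<and> infinite_run stp {c. (x, rank c) \<in> r} c g \<and> f \<noteq> g"
      if "(x, rank c) \<in> r" "x \<noteq> rank c" for x c
      using that by (rule rank_two_runs)
    show "f = g" if "c \<notin> {c. fst c = Kernel}" "infinite_run stp {c'. (rank c, rank c') \<in> r} c f"
      "infinite_run stp {c'. (rank c, rank c') \<in> r} c g" for c f g
      using that by (intro rank_one_run) auto
    show "\<exists>w\<in>ct.T - {[]}. ct.conf w \<notin> {c. fst c = Kernel} \<and> rank (ct.conf w) = x" if "x \<in> Field r" for x
    proof -
      let ?R = "(\<lambda>_. 0)(X := x)"
      have "\<exists>w\<in>ct.T - {[]}. ct.conf w = (Spine, ?R)"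
        by (rule ct.conf_surj[of Spine "OInc Z"]) (auto simp: D_iff)
      then obtain w where w: "w \<in> ct.T - {[]}" "ct.conf w = (Spine, ?R)" by blast
      have "rank (Spine, ?R) = x" using that by (simp add: rank_Spine spine_rank_def)
      then show ?thesis using w by (intro bexI[of _ w]) simp_all
    qed
  qed
  show ?thesis
    using ct.successor_tree ct.automatic_T rf.has_CB_rank[OF assms] by blast
qed

text \<open>An empty order has no least element to serve as \<open>bottom\<close>. The
  \<open>Kernel\<close> loops alone already give a tree equal to its own derivative.\<close>

lemma automatic_tree_of_rank_0:
  assumes "Well_order \<alpha>" "Field \<alpha> = {}"
  shows "\<exists>(T :: nat list set) (S :: nat list rel).
    successor_tree T S \<and> automatic T S \<and> has_CB_rank T (tree_order T S) \<alpha>"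
proof -
  have "finite kernel_trans" by (simp add: kernel_trans_def)
  then obtain code :: "trans \<times> nat set \<Rightarrow> nat" where code: "inj_on code (kernel_trans \<times> Pow {..<2})"
    using ex_code by blast
  have neq: "R(0 := Suc (R 0)) \<noteq> R(1 := Suc (R 1))" for R :: "nat \<Rightarrow> nat"
    by (metis fun_upd_other fun_upd_same n_not_Suc_n zero_neq_one)
  interpret ct: counter_tree 2 2 kernel_trans code
  proof
    show "a = b" if "(q, a, q') \<in> kernel_trans" "(q, b, q') \<in> kernel_trans" "sem 2 a R R'" "sem 2 b R R'"
      for q a q' b R R'
      using that neq[of R] by (auto simp: kernel_trans_def)
  qed (use code in \<open>auto simp: kernel_trans_def\<close>)
  have state: "fst (ct.conf w) = Kernel" if w: "w \<in> ct.T - {[]}" for w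
  proof -
    obtain h R where h: "ct.node h R" "h \<noteq> []" "w = ct.enc h R" using w ct.nonempty_node by blast
    then have "last h \<in> kernel_trans" unfolding ct.node_def by auto
    then have "snd (snd (last h)) = Kernel" by (auto simp: kernel_trans_def)
    then show ?thesis using h by (simp add: ct.conf_enc)
  qed
  interpret cf: configured_forest ct.T "[]" ct.E length ct.conf "config_step 2 kernel_trans" "{c. fst c = Kernel}"
  proof unfold_locales
    show "(ct.conf u, ct.conf v) \<in> config_step 2 kernel_trans" if "(u, v) \<in> ct.E" for u v
      using that by (rule ct.E_stp)
    show "\<exists>v. (u, v) \<in> ct.E \<and> ct.conf v = c"
      if "u \<in> ct.T - {[]}" "(ct.conf u, c) \<in> config_step 2 kernel_trans" for u c
      using that by (rule ct.stp_E)
    show "v = v'" if "(u, v) \<in> ct.E" "(u, v') \<in> ct.E" "ct.conf v = ct.conf v'" for u v v'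
      using that by (rule ct.conf_sibling)
    have "(Kernel, OInc 0, Kernel) \<in> kernel_trans" by (simp add: kernel_trans_def)
    then show "\<exists>w\<in>ct.T - {[]}. ct.conf w \<in> {c. fst c = Kernel}"
      by (auto dest!: ct.conf_surj[of Kernel "OInc 0" Kernel "\<lambda>_. 0", OF _ refl] intro: bexI[rotated])
    show "\<exists>c1\<in>{c. fst c = Kernel}. \<exists>c2\<in>{c. fst c = Kernel}.
        c1 \<noteq> c2 \<and> (c, c1) \<in> config_step 2 kernel_trans \<and> (c, c2) \<in> config_step 2 kernel_trans"
      if "c \<in> {c. fst c = Kernel}" for c
      using that by (intro kernel_step_two) simp_all
    show "c \<in> {c. fst c = Kernel}"
      if "(c, c') \<in> config_step 2 kernel_trans" for c c'
      using that by (auto simp: config_step_def kernel_trans_def)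
  qed
  have "cf.nodes {c. fst c = Kernel} = ct.T"
    unfolding cf.nodes_def using state ct.root_in_T by auto
  then have "derivative (tree_order ct.T ct.S) ct.T = ct.T"
    using cf.derivative_kern by simp
  moreover have "iter_derivative (tree_order ct.T ct.S) ct.T \<alpha> = ct.T"
    using assms by (subst iter_derivative.simps) simp
  moreover have "\<not> \<beta> <o \<alpha>" for \<beta> :: "'a rel"
  proof
    assume "\<beta> <o \<alpha>"
    then obtain f where "Well_order \<beta>" "embedS \<beta> \<alpha> f" unfolding ordLess_def by blast
    then have "f ` Field \<beta> \<subset> Field \<alpha>" using embedS_iff[of \<beta> \<alpha> f] by (simp add: embedS_def)
    then show False using assms(2) by simp
  qed
  ultimately have "has_CB_rank ct.T (tree_order ct.T ct.S) \<alpha>"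
    unfolding has_CB_rank_def using assms(1) by simp
  then show ?thesis using ct.successor_tree ct.automatic_T by blast
qed

theorem theorem4:
  fixes \<alpha> :: "'o rel"
  assumes "\<alpha> <o omega1CK"
  shows "\<exists>(T :: nat list set) (S :: nat list rel).
           successor_tree T S \<and> automatic T S \<and> has_CB_rank T (tree_order T S) \<alpha>"
proof -
  have \<alpha>: "Well_order \<alpha>" using assms unfolding ordLess_def by blast
  obtain r :: "nat rel" where r: "Well_order r" "computable_rel r" "\<alpha> =o r"
    using less_omega1CK_computable[OF assms] unfolding computable_ordinal_def by blast
  then obtain p where p: "\<And>x y. \<exists>n. let c = (step p ^^ n) (initial_config x y) in
      halted p c \<and> snd c 0 = (if (x, y) \<in> r then 1 else 0)"
    unfolding computable_rel_def by blast
  show ?thesis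
  proof (cases "Field \<alpha> = {}")
    case True
    with \<alpha> show ?thesis by (rule automatic_tree_of_rank_0)
  next
    case False
    obtain f where "bij_betw f (Field \<alpha>) (Field r)" using r(3) unfolding ordIso_def iso_def by blast
    then have "Field r \<noteq> {}" using False by (auto simp: bij_betw_def)
    \<comment> \<open>The sum bounds every register named in \<open>p\<close>; the summand 2 makes
      the bound strict and leaves room for the input registers 0 and 1.\<close>
    moreover have "instr_register ins < 2 + sum_list (map instr_register p)" if "ins \<in> set p" for ins
      using member_le_sum_list[of "instr_register ins" "map instr_register p"] that by simp
    ultimately interpret order_machine p "2 + sum_list (map instr_register p)" r
      using r(1) p by unfold_locales auto
    show ?thesis using r(3) by (rule automatic_tree_of_rank)
  qed
qed

end
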